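(* Let $C\in\mathbb D_0$. Then (1) $\tau_{C^\beta}=q_C$; (2) $\bar K_C^\flat=\bar K_{C^\beta}$. Moreover $C^\beta\in\mathbb D_0$ and $(C^\beta)^\beta=C$, so $C\mapsto C^\beta$ is an involution of $\mathbb D_0$.
   Context: Fix an integer $r>1$ and constants $a_1,\dots,a_{r-2}\in\mathbb C$, and let $L_0=\partial^r-a_{r-2}\partial^{r-2}-\cdots-a_1\partial-x$, where $\partial=d/dx$. Fix a basis $f_1,\dots,f_r$ of $\ker L_0$ normalized so that $|Wr(f_1,\dots,f_r)|=1$. For a function $f$ of one variable write $\hat f(x,z)=f(x+z)$. $\mathcal S$ denotes the space of finitely supported distributions in the $z$-plane: finite linear combinations of $\delta_\lambda\circ\partial_z^j$, where $\delta_\lambda$ evaluates its argument at $z=\lambda$; applied to a function of $(x,z)$ such a distribution acts in $z$ and yields a function of $x$. $\mathbb D$ is the set of finite-dimensional subspaces $C\subset\mathcal S$ having a basis $c_i=\delta_{\lambda_i}\circ(\partial_z+\gamma_i)$, $i=1,\dots,n$ ($n\ge1$), with $\lambda_i$ pairwise distinct and $\gamma_i\in\mathbb C$; $q_C(z):=\prod_{i=1}^n(z-\lambda_i)$. For $C\in\mathbb D$ put $N=rn$, let $\phi_1,\dots,\phi_N$ be the functions $c_i(\hat f_j)$, and let $\bar K_C$ be the operator $u\mapsto\kappa\,|Wr(\phi_1,\dots,\phi_N,u)|$ with $\kappa$ the nonzero constant making the coefficient of $\partial^N$ a monic polynomial; this coefficient, a monic polynomial of degree $n$, is denoted $\tau_C(x)$.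 $Wr(v_1,\dots,v_m)$ is the matrix with first row $(v_1,\dots,v_m)$ and each subsequent row the derivative of the previous. $\mathbb D_0:=\{C\in\mathbb D:\tau_C\text{ has distinct roots}\}$. $\flat$ is the unique $\mathbb C$-linear anti-automorphism of the Weyl algebra $\mathbb C[x]\langle\partial\rangle$ with $x^\flat=L_0$, $\partial^\flat=\partial$ (equivalently $T(x,\partial_x)\hat f(x,z)=T^\flat(z,\partial_z)\hat f(x,z)$ for all $f\in\ker L_0$). $C^\beta:=\{c\in\mathcal S: c(\hat f)\in\ker\bar K_C^\flat\text{ for all }f\in\ker L_0\}$. *)

theory Defs
  imports "HOL-Analysis.Analysis" "HOL-Computational_Algebra.Polynomial"
    "Jordan_Normal_Form.Determinant"
begin

text \<open>An element of the Weyl algebra is written uniquely as sum_k p_k(x) d^k; we represent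
it by the polynomial in d whose k-th coefficient is the polynomial p_k(x).\<close>

type_synonym weyl = "complex poly poly"

definition wact :: "weyl \<Rightarrow> (complex \<Rightarrow> complex) \<Rightarrow> complex \<Rightarrow> complex" where
  "wact T u = (\<lambda>x. \<Sum>k\<le>degree T. poly (coeff T k) x * (deriv ^^ k) u x)"

definition wmult :: "weyl \<Rightarrow> weyl \<Rightarrow> weyl" where
  "wmult A B = (\<Sum>i\<le>degree A. \<Sum>j\<le>degree B. \<Sum>l\<le>i.
      monom (Polynomial.smult (of_nat (i choose l)) (coeff A i * (pderiv ^^ l) (coeff B j))) (i + j - l))"

definition wpow :: "weyl \<Rightarrow> nat \<Rightarrow> weyl" where
  "wpow A n = ((wmult A) ^^ n) 1"

definition L0w :: "nat \<Rightarrow> (nat \<Rightarrow> complex) \<Rightarrow> weyl" where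
  "L0w r a = monom 1 r - (\<Sum>k\<in>{1..r-2}. monom [:a k:] k) - [:[:0, 1:]:]"

definition kerL0 :: "nat \<Rightarrow> (nat \<Rightarrow> complex) \<Rightarrow> (complex \<Rightarrow> complex) set" where
  "kerL0 r a = {g. g holomorphic_on UNIV \<and> wact (L0w r a) g = (\<lambda>_. 0)}"

definition pL0 :: "nat \<Rightarrow> (nat \<Rightarrow> complex) \<Rightarrow> complex poly \<Rightarrow> weyl" where
  "pL0 r a p = (\<Sum>j\<le>degree p. Polynomial.smult [:coeff p j:] (wpow (L0w r a) j))"

text \<open>The anti-automorphism flat with x |-> L_0, d |-> d:
  (sum_k p_k(x) d^k)^flat = sum_k d^k p_k(L_0).\<close>
definition wflat :: "nat \<Rightarrow> (nat \<Rightarrow> complex) \<Rightarrow> weyl \<Rightarrow> weyl" where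
  "wflat r a T = (\<Sum>k\<le>degree T. wmult (monom 1 k) (pL0 r a (coeff T k)))"

text \<open>A distribution D in S is represented by D :: complex => complex poly with finite support:
  D = sum_mu sum_j coeff (D mu) j * (delta_mu o d_z^j).\<close>

type_synonym sdist = "complex \<Rightarrow> complex poly"

definition Sdist :: "sdist set" where
  "Sdist = {D. finite {\<mu>. D \<mu> \<noteq> 0}}"

definition dapp :: "sdist \<Rightarrow> (complex \<Rightarrow> complex) \<Rightarrow> complex" where
  "dapp D g = (\<Sum>\<mu>\<in>{\<mu>. D \<mu> \<noteq> 0}. \<Sum>j\<le>degree (D \<mu>). coeff (D \<mu>) j * (deriv ^^ j) g \<mu>)"

definition dhat :: "sdist \<Rightarrow> (complex \<Rightarrow> complex) \<Rightarrow> complex \<Rightarrow> complex" where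
  "dhat D g = (\<lambda>x. dapp D (\<lambda>z. g (x + z)))"

definition cbasis :: "(nat \<Rightarrow> complex) \<Rightarrow> (nat \<Rightarrow> complex) \<Rightarrow> nat \<Rightarrow> sdist" where
  "cbasis lam gam i = (\<lambda>\<mu>. if \<mu> = lam i then [:gam i, 1:] else 0)"

definition dspan :: "nat \<Rightarrow> (nat \<Rightarrow> complex) \<Rightarrow> (nat \<Rightarrow> complex) \<Rightarrow> sdist set" where
  "dspan n lam gam = range (\<lambda>t. (\<lambda>\<mu>. \<Sum>i<n. Polynomial.smult (t i) (cbasis lam gam i \<mu>)))"

definition Dbasis :: "sdist set \<Rightarrow> nat \<times> (nat \<Rightarrow> complex) \<times> (nat \<Rightarrow> complex) \<Rightarrow> bool" where
  "Dbasis C b = (case b of (n, lam, gam) \<Rightarrow>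
      n \<ge> 1 \<and> inj_on lam {..<n} \<and> C = dspan n lam gam)"

definition inD :: "sdist set \<Rightarrow> bool" where
  "inD C = (\<exists>b. Dbasis C b)"

definition suppC :: "sdist set \<Rightarrow> complex set" where
  "suppC C = {\<mu>. \<exists>D\<in>C. D \<mu> \<noteq> 0}"

definition qC :: "sdist set \<Rightarrow> complex poly" where
  "qC C = (\<Prod>\<mu>\<in>suppC C. [:-\<mu>, 1:])"

definition nC :: "sdist set \<Rightarrow> nat" where
  "nC C = card (suppC C)"

definition wronsk :: "(nat \<Rightarrow> complex \<Rightarrow> complex) \<Rightarrow> nat \<Rightarrow> complex \<Rightarrow> complex" where
  "wronsk v m x = det (mat m m (\<lambda>(i, j). (deriv ^^ i) (v j) x))"

definition phis :: "nat \<Rightarrow> (nat \<Rightarrow> complex \<Rightarrow> complex) \<Rightarrow> (nat \<Rightarrow> complex) \<Rightarrow> (nat \<Rightarrow> complex)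
    \<Rightarrow> nat \<Rightarrow> complex \<Rightarrow> complex" where
  "phis r f lam gam p = dhat (cbasis lam gam (p div r)) (f (p mod r))"

definition Kbar :: "nat \<Rightarrow> (nat \<Rightarrow> complex) \<Rightarrow> (nat \<Rightarrow> complex \<Rightarrow> complex) \<Rightarrow> sdist set \<Rightarrow> weyl" where
  "Kbar r a f C = (case (SOME b. Dbasis C b) of (n, lam, gam) \<Rightarrow>
     (SOME T. lead_coeff (coeff T (r * n)) = 1 \<and>
        (\<exists>\<kappa>. \<kappa> \<noteq> 0 \<and> (\<forall>u. u holomorphic_on UNIV \<longrightarrow>
           (\<forall>x. wact T u x =
                 \<kappa> * wronsk (\<lambda>p. if p < r * n then phis r f lam gam p else u) (r * n + 1) x)))))"

definition tau :: "nat \<Rightarrow> (nat \<Rightarrow> complex) \<Rightarrow> (nat \<Rightarrow> complex \<Rightarrow> complex) \<Rightarrow> sdist set \<Rightarrow> complex poly" where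
  "tau r a f C = coeff (Kbar r a f C) (r * nC C)"

definition D0 :: "nat \<Rightarrow> (nat \<Rightarrow> complex) \<Rightarrow> (nat \<Rightarrow> complex \<Rightarrow> complex) \<Rightarrow> sdist set set" where
  "D0 r a f = {C. inD C \<and> rsquarefree (tau r a f C)}"

definition Cbeta :: "nat \<Rightarrow> (nat \<Rightarrow> complex) \<Rightarrow> (nat \<Rightarrow> complex \<Rightarrow> complex) \<Rightarrow> sdist set \<Rightarrow> sdist set" where
  "Cbeta r a f C = {c \<in> Sdist. \<forall>g\<in>kerL0 r a.
      wact (wflat r a (Kbar r a f C)) (dhat c g) = (\<lambda>_. 0)}"

end

theory Submission
  imports Defs "HOL-Complex_Analysis.Complex_Analysis" "Jordan_Normal_Form.Char_Poly"
begin

text \<open>Write $\hat f(x,z) = f(x+z)$, $p(t) = t^r - \sum_k a_k t^k$ and $Z = \mathrm{diag}(\lambda_i)$, and let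
$M$ be the Calogero--Moser matrix with off-diagonal entries $1/(\lambda_i-\lambda_j)$ and diagonal
entries $\gamma_i + q''(\lambda_i)/(2q'(\lambda_i))$. Reducing $\bar K_C \hat f$ modulo
$L_0\hat f = z\hat f$ and solving for the coefficients by Lagrange interpolation in $z$ gives
$\bar K_C\hat f = \tau(x)q(z)\hat f - \sum_m \mathbf 1^T \mathrm{adj}(z-Z)\, p_m(-M)\, \mathrm{adj}(x-X)\mathbf 1\;\partial^m\hat f$
with $X = p(-M) - Z$, $p_m$ the truncations in Horner's scheme for $p$, and $\tau = \det(x-X)$. This is
symmetric under $(x,Z,M) \leftrightarrow (z,X^T,M^T)$, which is the effect of $\flat$. At a simple root $\mu$ of
$\tau$ the commutator relation $XM - MX = 1 - \mathbf 1\mathbf 1^T$ makes $\ker(\mu-X)$ one-dimensional, and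
this yields the $\gamma'$ for which $\delta_\mu\circ(\partial+\gamma')$ is annihilated by $\bar K_C^\flat$.

An operator of order $N$ annihilating the $\phi_i$ is a constant multiple of their Wronskian operator as soon as
its two top coefficients are $t$ and $-t'$, by Abel's identity. Conversely a distribution $c$ is
annihilated by $K$ iff $c \circ K^\flat = 0$; if the top coefficients of $K^\flat$ are $t$ and $-t'$ with $t$
having simple roots, the two top coefficients of $c \circ K^\flat$ at a point of the support of $c$ show that
this point is a root of $t$ and that $c$ has order exactly 1 there.\<close>

text \<open>Origin of M: write the z-coefficients of the operator applied to f(x+z) in the Lagrange
  basis q_i = q/(z - lambda_i). At lambda_i, d_z + gamma_i then acts on coordinate vectors as row i
  of M, up to the factor q_i(lambda_i). Annihilation of the phi's becomes the recursion u_(m-1) = -M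
  u_m - a_m w, descending from u_(r-1) = w, and at m = 0 it closes up to (x - X) w = tau 1. Taking w
  = adj(x - X) 1 keeps everything polynomial in x. Role of the two top coefficients:
  \<open>Kbar\<close> is picked by choice, relative to a chosen basis, so it has to be recognized by
  properties, and Abel's identity makes the pair t, -t' together with the kernel sufficient. Since
  the formula contains polynomials in L_0, these coefficients are not visible in it. They are read
  off by giving d weight 1 and x weight r: pairs (order below r, power of x) then correspond one to
  one to weights, d^k reduces to a normal form with leading weight k, and the absence of d^(r-1) in
  L_0 leaves nothing in weight k - 1.\<close>

abbreviation entire :: "(complex \<Rightarrow> complex) \<Rightarrow> bool" where
  "entire g \<equiv> g holomorphic_on UNIV"

subsection \<open>Iterated derivatives of entire functions\<close>

lemma entire_higher_deriv: "entire g \<Longrightarrow> entire ((deriv ^^ k) g)"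
  by (rule holomorphic_higher_deriv) auto

lemma entire_higher_deriv_has_field_derivative:
  assumes "entire g"
  shows "((deriv ^^ k) g has_field_derivative (deriv ^^ Suc k) g x) (at x)"
  using holomorphic_derivI[OF entire_higher_deriv[OF assms, of k] open_UNIV, of x] by simp

lemma entire_shift: "entire g \<Longrightarrow> entire (\<lambda>x. g (x + z))"
  using holomorphic_on_compose_gen[of "\<lambda>x. x + z" UNIV g UNIV]
  by (simp add: o_def holomorphic_intros)

lemma entire_shift': "entire g \<Longrightarrow> entire (\<lambda>z. g (x + z))"
  using entire_shift[of g x] by (simp add: add.commute)

lemma higher_deriv_higher_deriv: "(deriv ^^ k) ((deriv ^^ j) g) = (deriv ^^ (k + j)) g"
  by (simp add: funpow_add)

lemma higher_deriv_shift: "(deriv ^^ k) (\<lambda>x. g (x + z)) = (\<lambda>x. (deriv ^^ k) g (x + z))"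
  by (induction k) (simp_all add: deriv_def DERIV_shift)

lemma higher_deriv_shift': "(deriv ^^ k) (\<lambda>z. g (x + z)) = (\<lambda>z. (deriv ^^ k) g (x + z))"
  using higher_deriv_shift[of k g x] by (simp add: add.commute)

lemma higher_deriv_sum_entire:
  assumes "\<And>i. i \<in> I \<Longrightarrow> entire (F i)"
  shows "(deriv ^^ n) (\<lambda>y. \<Sum>i\<in>I. F i y) x = (\<Sum>i\<in>I. (deriv ^^ n) (F i) x)"
  using assms
proof (induction I rule: infinite_finite_induct)
  case (insert i I)
  have "entire (\<lambda>y. \<Sum>i\<in>I. F i y)"
    using insert by (intro holomorphic_intros) auto
  then show ?case
    using insert higher_deriv_add[of "F i" UNIV "\<lambda>y. \<Sum>i\<in>I. F i y" x n] by simp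
qed auto

lemma higher_deriv_cmult_entire:
  "entire g \<Longrightarrow> (deriv ^^ n) (\<lambda>y. c * g y) x = c * (deriv ^^ n) g x"
  by (rule higher_deriv_cmult[of _ UNIV]) auto

lemma higher_deriv_lincomb_entire:
  assumes "\<And>i. i \<in> I \<Longrightarrow> entire (F i)"
  shows "(deriv ^^ n) (\<lambda>y. \<Sum>i\<in>I. c i * F i y) x = (\<Sum>i\<in>I. c i * (deriv ^^ n) (F i) x)"
proof -
  have "(deriv ^^ n) (\<lambda>y. \<Sum>i\<in>I. c i * F i y) x = (\<Sum>i\<in>I. (deriv ^^ n) (\<lambda>y. c i * F i y) x)"
    using assms by (intro higher_deriv_sum_entire holomorphic_intros) auto
  also have "\<dots> = (\<Sum>i\<in>I. c i * (deriv ^^ n) (F i) x)"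
    using assms by (intro sum.cong refl higher_deriv_cmult_entire) auto
  finally show ?thesis .
qed

lemma higher_deriv_poly: "(deriv ^^ l) (poly p) = poly ((pderiv ^^ l) p)"
  for p :: "complex poly"
proof (induction l)
  case (Suc l)
  have "deriv (poly q) = poly (pderiv q)" for q :: "complex poly"
    by (rule ext) (rule DERIV_imp_deriv[OF poly_DERIV])
  then show ?case using Suc by simp
qed simp

lemma entire_poly: "entire (poly p)" for p :: "complex poly"
  by (intro holomorphic_intros)

subsection \<open>The action of the Weyl algebra\<close>

lemma wact_bound:
  assumes "degree T \<le> N"
  shows "wact T u x = (\<Sum>k\<le>N. poly (coeff T k) x * (deriv ^^ k) u x)"
  unfolding wact_def using assms
  by (intro sum.mono_neutral_left) (auto simp: coeff_eq_0)

lemma wact_0: "wact 0 u x = 0"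
  by (simp add: wact_def)

lemma wact_add: "wact (A + B) u x = wact A u x + wact B u x"
proof -
  let ?N = "max (degree A) (degree B)"
  have "degree (A + B) \<le> ?N" by (rule degree_add_le_max)
  then show ?thesis
    by (simp add: wact_bound[of _ ?N] sum.distrib algebra_simps)
qed

lemma wact_smult: "wact (Polynomial.smult p T) u x = poly p x * wact T u x"
  by (simp add: wact_bound[of _ "degree T"] degree_smult_le sum_distrib_left mult.assoc)

lemma wact_uminus: "wact (- T) u x = - wact T u x"
  using wact_smult[of "-1" T u x] by simp

lemma wact_diff: "wact (A - B) u x = wact A u x - wact B u x"
  using wact_add[of A "- B" u x] by (simp add: wact_uminus)

lemma wact_sum: "wact (\<Sum>i\<in>I. F i) u x = (\<Sum>i\<in>I. wact (F i) u x)"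
  by (induction I rule: infinite_finite_induct) (auto simp: wact_0 wact_add)

lemma wact_monom: "wact (monom p k) u x = poly p x * (deriv ^^ k) u x"
proof -
  have "wact (monom p k) u x = (\<Sum>j\<le>k. poly (coeff (monom p k) j) x * (deriv ^^ j) u x)"
    by (intro wact_bound degree_monom_le)
  also have "\<dots> = (\<Sum>j\<in>{k}. poly p x * (deriv ^^ j) u x)"
    by (intro sum.mono_neutral_cong_right) auto
  finally show ?thesis by simp
qed

lemma wact_1: "wact 1 u x = u x"
  using wact_monom[of 1 0 u x] by (simp add: monom_0 one_pCons)

lemma entire_wact: "entire u \<Longrightarrow> entire (wact T u)"
  unfolding wact_def by (intro holomorphic_intros entire_higher_deriv) auto

lemma wact_lincomb:
  assumes "\<And>i. i \<in> I \<Longrightarrow> entire (F i)"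
  shows "wact T (\<lambda>y. \<Sum>i\<in>I. c i * F i y) x = (\<Sum>i\<in>I. c i * wact T (F i) x)"
proof -
  have "wact T (\<lambda>y. \<Sum>i\<in>I. c i * F i y) x
      = (\<Sum>k\<le>degree T. \<Sum>i\<in>I. c i * (poly (coeff T k) x * (deriv ^^ k) (F i) x))"
    using assms by (simp add: wact_def higher_deriv_lincomb_entire sum_distrib_left mult_ac)
  also have "\<dots> = (\<Sum>i\<in>I. c i * wact T (F i) x)"
    unfolding wact_def sum_distrib_left by (rule sum.swap)
  finally show ?thesis .
qed

lemma wact_cmult: "entire u \<Longrightarrow> wact T (\<lambda>y. c * u y) x = c * wact T u x"
  using wact_lincomb[of "{()}" "\<lambda>_. u" T "\<lambda>_. c" x] by simp

lemma wact_wmult: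
  assumes u: "entire u"
  shows "wact (wmult A B) u x = wact A (wact B u) x"
proof -
  have eB: "entire (\<lambda>y. poly (coeff B j) y * (deriv ^^ j) u y)" for j
    using u by (intro holomorphic_intros entire_higher_deriv)
  have "(deriv ^^ i) (wact B u) x = (\<Sum>j\<le>degree B. \<Sum>l\<le>i.
      of_nat (i choose l) * poly ((pderiv ^^ l) (coeff B j)) x * (deriv ^^ (i + j - l)) u x)" for i
  proof -
    have "(deriv ^^ i) (wact B u) x
        = (\<Sum>j\<le>degree B. (deriv ^^ i) (\<lambda>y. poly (coeff B j) y * (deriv ^^ j) u y) x)"
      unfolding wact_def by (intro higher_deriv_sum_entire eB)
    also have "\<dots> = (\<Sum>j\<le>degree B. \<Sum>l\<le>i.
      of_nat (i choose l) * poly ((pderiv ^^ l) (coeff B j)) x * (deriv ^^ (i + j - l)) u x)"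
    proof (intro sum.cong refl)
      fix j
      have "(deriv ^^ (i - l)) ((deriv ^^ j) u) = (deriv ^^ (i + j - l)) u" if "l \<le> i" for l
        using that by (simp add: higher_deriv_higher_deriv)
      then show "(deriv ^^ i) (\<lambda>y. poly (coeff B j) y * (deriv ^^ j) u y) x
        = (\<Sum>l\<le>i. of_nat (i choose l) * poly ((pderiv ^^ l) (coeff B j)) x * (deriv ^^ (i + j - l)) u x)"
        using higher_deriv_mult[OF entire_poly[of "coeff B j"] entire_higher_deriv[OF u, of j] open_UNIV, of x i]
        by (simp add: higher_deriv_poly atLeast0AtMost)
    qed
    finally show ?thesis .
  qed
  then have "wact A (wact B u) x = (\<Sum>i\<le>degree A. poly (coeff A i) x * (\<Sum>j\<le>degree B. \<Sum>l\<le>i.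
      of_nat (i choose l) * poly ((pderiv ^^ l) (coeff B j)) x * (deriv ^^ (i + j - l)) u x))"
    by (simp add: wact_def[of A])
  also have "\<dots> = wact (wmult A B) u x"
    by (simp add: wmult_def wact_sum wact_monom sum_distrib_left mult_ac)
  finally show ?thesis by simp
qed

subsection \<open>Finitely supported distributions\<close>

definition pact :: "complex poly \<Rightarrow> (complex \<Rightarrow> complex) \<Rightarrow> complex \<Rightarrow> complex" where
  "pact p g \<mu> = (\<Sum>j\<le>degree p. coeff p j * (deriv ^^ j) g \<mu>)"

lemma pact_bound:
  assumes "degree p \<le> N"
  shows "pact p g \<mu> = (\<Sum>k\<le>N. coeff p k * (deriv ^^ k) g \<mu>)"
  unfolding pact_def using assms
  by (intro sum.mono_neutral_left) (auto simp: coeff_eq_0)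

lemma pact_0: "pact 0 g \<mu> = 0"
  by (simp add: pact_def)

lemma pact_add: "pact (p + q) g \<mu> = pact p g \<mu> + pact q g \<mu>"
proof -
  let ?N = "max (degree p) (degree q)"
  have "degree (p + q) \<le> ?N" by (rule degree_add_le_max)
  then show ?thesis
    by (simp add: pact_bound[of _ ?N] sum.distrib algebra_simps)
qed

lemma pact_smult: "pact (Polynomial.smult c p) g \<mu> = c * pact p g \<mu>"
  by (simp add: pact_bound[of _ "degree p"] degree_smult_le sum_distrib_left mult.assoc)

lemma pact_linear: "pact [:c, d:] g \<mu> = c * g \<mu> + d * deriv g \<mu>"
  by (subst pact_bound[of _ 1]) (auto simp: degree_pCons_le)

lemma dapp_superset:
  assumes "finite S" "{\<mu>. D \<mu> \<noteq> 0} \<subseteq> S"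
  shows "dapp D g = (\<Sum>\<mu>\<in>S. pact (D \<mu>) g \<mu>)"
  unfolding dapp_def pact_def[symmetric] using assms
  by (intro sum.mono_neutral_left) (auto simp: pact_0)

lemma dapp_lincomb_fun:
  assumes "\<And>i. i \<in> I \<Longrightarrow> entire (F i)"
  shows "dapp D (\<lambda>z. \<Sum>i\<in>I. c i * F i z) = (\<Sum>i\<in>I. c i * dapp D (F i))"
proof -
  have "pact p (\<lambda>z. \<Sum>i\<in>I. c i * F i z) \<mu> = (\<Sum>i\<in>I. c i * pact p (F i) \<mu>)" for p \<mu>
  proof -
    have "pact p (\<lambda>z. \<Sum>i\<in>I. c i * F i z) \<mu>
        = (\<Sum>k\<le>degree p. \<Sum>i\<in>I. c i * (coeff p k * (deriv ^^ k) (F i) \<mu>))"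
      using assms by (simp add: pact_def higher_deriv_lincomb_entire sum_distrib_left mult_ac)
    also have "\<dots> = (\<Sum>i\<in>I. c i * pact p (F i) \<mu>)"
      unfolding pact_def sum_distrib_left by (rule sum.swap)
    finally show ?thesis .
  qed
  then have "dapp D (\<lambda>z. \<Sum>i\<in>I. c i * F i z)
      = (\<Sum>\<mu>\<in>{\<mu>. D \<mu> \<noteq> 0}. \<Sum>i\<in>I. c i * pact (D \<mu>) (F i) \<mu>)"
    unfolding dapp_def pact_def[symmetric] by simp
  also have "\<dots> = (\<Sum>i\<in>I. c i * dapp D (F i))"
    unfolding dapp_def pact_def[symmetric] sum_distrib_left by (rule sum.swap)
  finally show ?thesis .
qed

lemma dapp_lincomb:
  assumes "finite I" "\<And>i. i \<in> I \<Longrightarrow> D i \<in> Sdist"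
  shows "dapp (\<lambda>\<mu>. \<Sum>i\<in>I. Polynomial.smult (t i) (D i \<mu>)) g = (\<Sum>i\<in>I. t i * dapp (D i) g)"
proof -
  define S where "S = (\<Union>i\<in>I. {\<mu>. D i \<mu> \<noteq> 0})"
  have S: "finite S" using assms by (auto simp: S_def Sdist_def)
  have *: "pact (\<Sum>i\<in>J. Polynomial.smult (t i) (D i \<mu>)) g \<mu> = (\<Sum>i\<in>J. t i * pact (D i \<mu>) g \<mu>)" for J \<mu>
    by (induction J rule: infinite_finite_induct) (auto simp: pact_0 pact_add pact_smult)
  have "dapp (\<lambda>\<mu>. \<Sum>i\<in>I. Polynomial.smult (t i) (D i \<mu>)) g
      = (\<Sum>\<mu>\<in>S. pact (\<Sum>i\<in>I. Polynomial.smult (t i) (D i \<mu>)) g \<mu>)"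
    by (rule dapp_superset[OF S]) (use sum.neutral[of I] in \<open>fastforce simp: S_def\<close>)
  also have "\<dots> = (\<Sum>i\<in>I. t i * (\<Sum>\<mu>\<in>S. pact (D i \<mu>) g \<mu>))"
    unfolding * sum_distrib_left by (rule sum.swap)
  also have "\<dots> = (\<Sum>i\<in>I. t i * dapp (D i) g)"
    by (intro sum.cong refl arg_cong2[where f = "(*)"] dapp_superset[OF S, symmetric]) (auto simp: S_def)
  finally show ?thesis .
qed

lemma dhat_eq: "dhat D g x = (\<Sum>\<mu>\<in>{\<mu>. D \<mu> \<noteq> 0}. \<Sum>j\<le>degree (D \<mu>). coeff (D \<mu>) j * (deriv ^^ j) g (x + \<mu>))"
  by (simp add: dhat_def dapp_def higher_deriv_shift')

lemma entire_dhat: "entire g \<Longrightarrow> entire (dhat D g)"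
  unfolding dhat_eq[abs_def]
  by (intro holomorphic_on_sum holomorphic_on_mult holomorphic_on_const
      entire_shift[OF entire_higher_deriv])

lemma higher_deriv_dhat:
  assumes g: "entire g"
  shows "(deriv ^^ k) (dhat D g) = dhat D ((deriv ^^ k) g)"
proof
  fix x
  have e: "entire (\<lambda>x. (deriv ^^ j) g (x + \<mu>))" for j \<mu>
    using g by (intro entire_shift entire_higher_deriv)
  have "(deriv ^^ k) (dhat D g) x = (\<Sum>\<mu>\<in>{\<mu>. D \<mu> \<noteq> 0}. (deriv ^^ k)
      (\<lambda>x. \<Sum>j\<le>degree (D \<mu>). coeff (D \<mu>) j * (deriv ^^ j) g (x + \<mu>)) x)"
    unfolding dhat_eq[abs_def] by (intro higher_deriv_sum_entire holomorphic_on_sum holomorphic_on_mult holomorphic_on_const e)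
  also have "\<dots> = (\<Sum>\<mu>\<in>{\<mu>. D \<mu> \<noteq> 0}. \<Sum>j\<le>degree (D \<mu>). coeff (D \<mu>) j * (deriv ^^ k) (\<lambda>x. (deriv ^^ j) g (x + \<mu>)) x)"
    by (intro sum.cong refl higher_deriv_lincomb_entire e)
  also have "\<dots> = dhat D ((deriv ^^ k) g) x"
    unfolding dhat_eq higher_deriv_shift higher_deriv_higher_deriv
    by (simp add: add.commute)
  finally show "(deriv ^^ k) (dhat D g) x = dhat D ((deriv ^^ k) g) x" .
qed

text \<open>\<open>T\<close> acts in x and \<open>D\<close> in z, so the two commute. Annihilation
  of \<open>dhat D g\<close> can therefore be tested on the function z |-> T g(x+z).\<close>

lemma wact_dhat:
  assumes g: "entire g"
  shows "wact T (dhat D g) x = dapp D (\<lambda>z. wact T (\<lambda>x. g (x + z)) x)"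
proof -
  have "wact T (dhat D g) x = (\<Sum>k\<le>degree T. poly (coeff T k) x * dapp D (\<lambda>z. (deriv ^^ k) g (x + z)))"
    by (simp add: wact_def higher_deriv_dhat[OF g]) (simp add: dhat_def)
  also have "\<dots> = dapp D (\<lambda>z. \<Sum>k\<le>degree T. poly (coeff T k) x * (deriv ^^ k) g (x + z))"
    using g by (intro dapp_lincomb_fun[symmetric] entire_shift' entire_higher_deriv)
  finally show ?thesis
    by (simp add: wact_def higher_deriv_shift)
qed

subsection \<open>Determinants\<close>

text \<open>Relations among rows are the useful ones here: for a Wronskian matrix at a point, the
  vector v is a constant-coefficient operator sum_i v_i d^i whose values on all the functions vanish
  at that point.\<close>

lemma det_eq_0_iff_row_null:
  fixes M :: "nat \<Rightarrow> nat \<Rightarrow> complex"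
  shows "Determinant.det (mat n n (\<lambda>(i, j). M i j)) = 0
    \<longleftrightarrow> (\<exists>v. (\<exists>i<n. v i \<noteq> 0) \<and> (\<forall>j<n. (\<Sum>i<n. v i * M i j) = 0))"
proof -
  let ?A = "mat n n (\<lambda>(i, j). M j i)"
  have "Determinant.det (mat n n (\<lambda>(i, j). M i j)) = Determinant.det (transpose_mat (mat n n (\<lambda>(i, j). M i j)))"
    by (rule det_transpose[symmetric, of _ n]) simp
  also have "transpose_mat (mat n n (\<lambda>(i, j). M i j)) = ?A"
    by (rule eq_matI) auto
  finally have "Determinant.det (mat n n (\<lambda>(i, j). M i j)) = 0
    \<longleftrightarrow> (\<exists>v. v \<in> carrier_vec n \<and> v \<noteq> 0\<^sub>v n \<and> ?A *\<^sub>v v = 0\<^sub>v n)"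
    using det_0_iff_vec_prod_zero[of ?A n] by simp
  also have "\<dots> \<longleftrightarrow> (\<exists>v. (\<exists>i<n. v i \<noteq> 0) \<and> (\<forall>j<n. (\<Sum>i<n. v i * M i j) = 0))"
  proof
    assume "\<exists>v. v \<in> carrier_vec n \<and> v \<noteq> 0\<^sub>v n \<and> ?A *\<^sub>v v = 0\<^sub>v n"
    then obtain v where v: "v \<in> carrier_vec n" "v \<noteq> 0\<^sub>v n" "?A *\<^sub>v v = 0\<^sub>v n" by blast
    have "\<exists>i<n. vec_index v i \<noteq> 0"
      using v(1,2) by (metis carrier_vecD eq_vecI index_zero_vec)
    moreover have "(\<Sum>i<n. vec_index v i * M i j) = 0" if "j < n" for j
    proof -
      have "vec_index (?A *\<^sub>v v) j = 0" using v(3) that by simp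
      then show ?thesis using that v(1)
        by (simp add: scalar_prod_def atLeast0LessThan mult.commute)
    qed
    ultimately show "\<exists>v. (\<exists>i<n. v i \<noteq> 0) \<and> (\<forall>j<n. (\<Sum>i<n. v i * M i j) = 0)"
      by (intro exI[of _ "\<lambda>i. vec_index v i"]) auto
  next
    assume "\<exists>v. (\<exists>i<n. v i \<noteq> 0) \<and> (\<forall>j<n. (\<Sum>i<n. v i * M i j) = 0)"
    then obtain v i where v: "i < n" "v i \<noteq> 0" "\<And>j. j < n \<Longrightarrow> (\<Sum>i<n. v i * M i j) = 0" by blast
    have "vec n v \<noteq> 0\<^sub>v n"
      using v(1,2) by (metis index_vec index_zero_vec(1))
    moreover have "?A *\<^sub>v vec n v = 0\<^sub>v n"
      using v(3) by (intro eq_vecI) (auto simp: scalar_prod_def atLeast0LessThan mult.commute)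
    ultimately show "\<exists>v. v \<in> carrier_vec n \<and> v \<noteq> 0\<^sub>v n \<and> ?A *\<^sub>v v = 0\<^sub>v n"
      by (intro exI[of _ "vec n v"]) auto
  qed
  finally show ?thesis .
qed

text \<open>Normal forms are computed in the single variable y = x + z; their top coefficients
  survive the rewriting as polynomials in z.\<close>

lemma coeff_pcompose_linear_top:
  fixes p :: "complex poly"
  assumes "degree p \<le> e"
  shows "coeff (pcompose p [:x, 1:]) e = coeff p e"
proof (cases "degree p = e")
  case True
  then show ?thesis
    using lead_coeff_comp[of "[:x, 1:]" p] by (simp add: degree_pcompose)
next
  case False
  then show ?thesis using assms by (simp add: coeff_eq_0 degree_pcompose)
qed

subsection \<open>Reduction modulo the generalized Airy equation\<close>

locale airy =
  fixes r :: nat and a :: "nat \<Rightarrow> complex" and f :: "nat \<Rightarrow> complex \<Rightarrow> complex"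
  assumes r: "r > 1"
    and f_ker: "\<And>j. j < r \<Longrightarrow> f j \<in> kerL0 r a"
    and wronsk_f: "\<And>x. wronsk f r x = 1"
begin

text \<open>Padding by zeros lets Horner's scheme and the sums run over all m < r. The value 0 at r
  - 1 records that L_0 has no term of order r - 1.\<close>

definition ac :: "nat \<Rightarrow> complex" where
  "ac m = (if m \<in> {1..r - 2} then a m else 0)"

lemma ac_0 [simp]: "ac 0 = 0" and ac_last: "ac (r - Suc 0) = 0"
  using r by (auto simp: ac_def)

lemma kerL0_entire: "g \<in> kerL0 r a \<Longrightarrow> entire g"
  by (simp add: kerL0_def)

lemma f_entire: "j < r \<Longrightarrow> entire (f j)"
  using f_ker kerL0_entire by blast

lemma wact_L0w:
  "wact (L0w r a) g x = (deriv ^^ r) g x - (\<Sum>m<r. ac m * (deriv ^^ m) g x) - x * g x"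
proof -
  have "wact (L0w r a) g x = (deriv ^^ r) g x - (\<Sum>m\<in>{1..r-2}. a m * (deriv ^^ m) g x) - x * g x"
    unfolding L0w_def monom_0[of "[:0, 1:]", symmetric]
    by (simp add: wact_diff wact_sum wact_monom)
  also have "(\<Sum>m\<in>{1..r-2}. a m * (deriv ^^ m) g x) = (\<Sum>m<r. ac m * (deriv ^^ m) g x)"
    using r by (intro sum.mono_neutral_cong_left) (auto simp: ac_def)
  finally show ?thesis .
qed

lemma kerL0_deriv_r:
  assumes "g \<in> kerL0 r a"
  shows "(deriv ^^ r) g x = (\<Sum>m<r. ac m * (deriv ^^ m) g x) + x * g x"
proof -
  have "(deriv ^^ r) g x - (\<Sum>m<r. ac m * (deriv ^^ m) g x) - x * g x = 0"
    using assms unfolding wact_L0w[symmetric] by (simp add: kerL0_def)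
  then show ?thesis by (simp add: algebra_simps)
qed

text \<open>If $u = \sum_m S_m(z)\, g^{(m)}(x+z)$ with $g \in \ker L_0$, then
  $\partial_z u$ has the coefficients \<open>dstep x S\<close>.\<close>

definition dstep :: "complex \<Rightarrow> (nat \<Rightarrow> complex poly) \<Rightarrow> nat \<Rightarrow> complex poly" where
  "dstep x S m = pderiv (S m) + (if m = 0 then [:x, 1:] * S (r - 1)
     else S (m - 1) + Polynomial.smult (ac m) (S (r - 1)))"

text \<open>Differentiation raises every order by one. Only order r leaves the range; the Airy
  equation at the point x + z folds it back, which is the source of the factor x + z at m =
  0.\<close>

lemma dstep_has_field_derivative:
  assumes g: "g \<in> kerL0 r a"
  shows "((\<lambda>z. \<Sum>m<r. poly (S m) z * (deriv ^^ m) g (x + z)) has_field_derivative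
     (\<Sum>m<r. poly (dstep x S m) z * (deriv ^^ m) g (x + z))) (at z)"
proof -
  define G where "G m = (deriv ^^ m) g (x + z)" for m
  define r' where "r' = r - 1"
  have lt: "{..<r} = {..<Suc r'}" and r1: "r - 1 = r'"  "(deriv ^^ r) g = (deriv ^^ Suc r') g"
    using r by (auto simp: r'_def)
  have d: "((\<lambda>z. (deriv ^^ m) g (x + z)) has_field_derivative G (Suc m)) (at z)" for m
    using entire_higher_deriv_has_field_derivative[OF kerL0_entire[OF g], of m "z + x"]
    unfolding G_def DERIV_shift by (simp add: add.commute)
  have G_r: "G (Suc r') = (\<Sum>m<r'. ac (Suc m) * G (Suc m)) + (x + z) * G 0"
    using kerL0_deriv_r[OF g, of "x + z"]
    unfolding lt r1 sum.lessThan_Suc_shift by (simp add: G_def)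
  have "((\<lambda>z. \<Sum>m<r. poly (S m) z * (deriv ^^ m) g (x + z)) has_field_derivative
     (\<Sum>m<r. poly (S m) z * G (Suc m) + poly (pderiv (S m)) z * (deriv ^^ m) g (x + z))) (at z)"
    by (intro DERIV_sum DERIV_mult' poly_DERIV d)
  also have "(\<Sum>m<r. poly (S m) z * G (Suc m) + poly (pderiv (S m)) z * (deriv ^^ m) g (x + z))
     = (\<Sum>m<r. poly (pderiv (S m)) z * G m) + (\<Sum>m<r. poly (S m) z * G (Suc m))"
    by (simp add: sum.distrib G_def)
  also have "(\<Sum>m<r. poly (S m) z * G (Suc m))
     = (x + z) * poly (S r') z * G 0
       + (\<Sum>m<r'. (poly (S m) z + ac (Suc m) * poly (S r') z) * G (Suc m))"
    unfolding lt sum.lessThan_Suc G_r by (simp add: algebra_simps sum.distrib sum_distrib_left)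
  also have "(\<Sum>m<r. poly (pderiv (S m)) z * G m) + \<dots> = (\<Sum>m<r. poly (dstep x S m) z * G m)"
    unfolding lt sum.lessThan_Suc_shift
    by (simp add: dstep_def r1[unfolded One_nat_def] algebra_simps sum.distrib sum_distrib_left)
  finally show ?thesis by (simp add: G_def)
qed

section \<open>Normal forms of iterated derivatives and their weights\<close>

primrec NF :: "nat \<Rightarrow> nat \<Rightarrow> complex poly" where
  "NF 0 = (\<lambda>m. if m = 0 then 1 else 0)"
| "NF (Suc k) = dstep 0 (NF k)"

lemma higher_deriv_NF:
  assumes g: "g \<in> kerL0 r a"
  shows "(deriv ^^ k) g y = (\<Sum>m<r. poly (NF k m) y * (deriv ^^ m) g y)"
proof (induction k arbitrary: y)
  case 0
  have "(\<Sum>m<r. poly (NF 0 m) y * (deriv ^^ m) g y) = (\<Sum>m\<in>{0::nat}. g y)"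
    using r by (intro sum.mono_neutral_cong_right) auto
  then show ?case by simp
next
  case (Suc k)
  have "(deriv ^^ k) g = (\<lambda>y. \<Sum>m<r. poly (NF k m) y * (deriv ^^ m) g y)"
    using Suc by blast
  then show ?case
    using dstep_has_field_derivative[OF g, of "NF k" 0 y] by (simp add: DERIV_imp_deriv)
qed

lemma coeff_dstep_0:
  "coeff (dstep 0 S m) e = of_nat (Suc e) * coeff (S m) (Suc e)
     + (if m = 0 then (if e = 0 then 0 else coeff (S (r - 1)) (e - 1))
        else coeff (S (m - 1)) e + ac m * coeff (S (r - 1)) e)"
  by (auto simp: dstep_def coeff_pderiv coeff_pCons split: nat.splits)

lemma NF_weight: "m < r \<Longrightarrow> coeff (NF k m) e \<noteq> 0 \<Longrightarrow> r * e + m \<le> k"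
proof (induction k arbitrary: m e)
  case 0
  then show ?case by (auto simp: one_pCons coeff_pCons split: if_splits nat.splits)
next
  case (Suc k)
  have *: "r * e + m \<le> Suc k" if "coeff (NF k m) (Suc e) \<noteq> 0"
    using Suc.IH[OF Suc.prems(1) that] by simp
  show ?case
  proof (cases m)
    case 0
    show ?thesis
    proof (cases e)
      case (Suc e')
      have "r * e' + (r - 1) \<le> k" if "coeff (NF k (r - 1)) e' \<noteq> 0"
        using Suc.IH[OF _ that] r by simp
      then show ?thesis using * Suc.prems r 0 Suc by (fastforce simp: coeff_dstep_0)
    qed (simp add: 0)
  next
    case (Suc m')
    have "r * e + (r - 1) \<le> k" if "coeff (NF k (r - 1)) e \<noteq> 0"
      using Suc.IH[OF _ that] r by simp
    moreover have "r * e + m' \<le> k" if "coeff (NF k m') e \<noteq> 0"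
      using Suc.IH[OF _ that] Suc.prems Suc by simp
    ultimately show ?thesis using * Suc.prems r Suc by (fastforce simp: coeff_dstep_0)
  qed
qed

lemma NF_weight_eq_0: "m < r \<Longrightarrow> k < r * e + m \<Longrightarrow> coeff (NF k m) e = 0"
  using NF_weight[of m k e] by linarith

text \<open>Division by r with remainder gives exactly one pair (m, e) of weight k. In top weight
  the derivative of the coefficients and the constants \<open>ac\<close> do not contribute, so the
  entry 1 is just passed on.\<close>

lemma NF_top: "m < r \<Longrightarrow> r * e + m = k \<Longrightarrow> coeff (NF k m) e = 1"
proof (induction k arbitrary: m e)
  case 0
  then show ?case using r by simp
next
  case (Suc k)
  have *: "coeff (NF k m) (Suc e) = 0"
    using Suc.prems r by (intro NF_weight_eq_0) auto
  show ?case
  proof (cases m)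
    case 0
    then obtain e' where e': "e = Suc e'" using Suc.prems by (cases e) auto
    have "coeff (NF k (r - 1)) e' = 1"
      using Suc.prems 0 e' r by (intro Suc.IH) auto
    then show ?thesis using * 0 e' by (simp add: coeff_dstep_0)
  next
    case m': (Suc m')
    have "coeff (NF k m') e = 1"
      using Suc.prems m' by (intro Suc.IH) auto
    moreover have "ac m * coeff (NF k (r - 1)) e = 0"
    proof (cases "m = r - 1")
      case False
      then show ?thesis using Suc.prems r by (simp add: NF_weight_eq_0)
    qed (simp add: ac_last)
    ultimately show ?thesis using * m' by (simp add: coeff_dstep_0)
  qed
qed

text \<open>A term with \<open>ac m\<close> lowers the weight gain by r - 1 - m, so it could reach
  this weight or a higher one only for m = r - 1, where \<open>ac\<close> vanishes; a
  \<open>pderiv\<close> term would need a source of weight above k.\<close>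

lemma NF_subtop: "m < r \<Longrightarrow> Suc (r * e + m) = k \<Longrightarrow> coeff (NF k m) e = 0"
proof (induction k arbitrary: m e)
  case (Suc k)
  have *: "coeff (NF k m) (Suc e) = 0"
    using Suc.prems r by (intro NF_weight_eq_0) auto
  show ?case
  proof (cases m)
    case 0
    show ?thesis
    proof (cases e)
      case (Suc e')
      have "coeff (NF k (r - 1)) e' = 0"
        using Suc.prems 0 Suc r by (intro Suc.IH) auto
      then show ?thesis using * 0 Suc by (simp add: coeff_dstep_0)
    qed (use * 0 in \<open>simp add: coeff_dstep_0\<close>)
  next
    case m': (Suc m')
    have "coeff (NF k m') e = 0"
      using Suc.prems m' by (intro Suc.IH) auto
    moreover have "ac m * coeff (NF k (r - 1)) e = 0"
    proof (cases "m = r - 1")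
      case False
      then show ?thesis using Suc.prems r by (simp add: NF_weight_eq_0)
    qed (simp add: ac_last)
    ultimately show ?thesis using * m' by (simp add: coeff_dstep_0)
  qed
qed simp

text \<open>Normal form of an operator sum_k t_k d^k with coefficients frozen at one point; usually
  \<open>t k = poly (coeff T k) x\<close>.\<close>

definition NFsum :: "(nat \<Rightarrow> complex) \<Rightarrow> nat \<Rightarrow> nat \<Rightarrow> complex poly" where
  "NFsum t d m = (\<Sum>k\<le>d. Polynomial.smult (t k) (NF k m))"

lemma coeff_NFsum: "coeff (NFsum t d m) e = (\<Sum>k\<le>d. t k * coeff (NF k m) e)"
  by (simp add: NFsum_def coeff_sum)

lemma coeff_NFsum_eq_0: "m < r \<Longrightarrow> d < r * e + m \<Longrightarrow> coeff (NFsum t d m) e = 0"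
  by (simp add: coeff_NFsum NF_weight_eq_0)

lemma coeff_NFsum_top:
  assumes "m < r" "r * e + m = d"
  shows "coeff (NFsum t d m) e = t d"
proof -
  have "coeff (NFsum t d m) e = (\<Sum>k\<in>{d}. t d)"
    unfolding coeff_NFsum using assms
    by (intro sum.mono_neutral_cong_right) (auto simp: NF_top NF_weight_eq_0)
  then show ?thesis by simp
qed

text \<open>The order d, which could interfere, has no component of weight d - 1 by
  \<open>NF_subtop\<close>. This makes the second coefficient of an operator readable.\<close>

lemma coeff_NFsum_subtop:
  assumes "m < r" "Suc (r * e + m) = d"
  shows "coeff (NFsum t d m) e = t (d - 1)"
proof -
  have "coeff (NFsum t d m) e = (\<Sum>k\<in>{d - 1}. t (d - 1))"
    unfolding coeff_NFsum
  proof (intro sum.mono_neutral_cong_right ballI)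
    fix k assume "k \<in> {..d} - {d - 1}"
    then have "k = d \<or> k < r * e + m" using assms by auto
    then show "t k * coeff (NF k m) e = 0"
      using NF_subtop[OF assms] NF_weight_eq_0[OF assms(1), of k e] by auto
  qed (use assms in \<open>auto simp: NF_top\<close>)
  then show ?thesis by simp
qed

lemma degree_NFsum: "m < r \<Longrightarrow> d < r * Suc e + m \<Longrightarrow> degree (NFsum t d m) \<le> e"
proof (intro degree_le allI impI)
  fix i assume "m < r" "d < r * Suc e + m" "e < i"
  moreover then have "r * Suc e \<le> r * i" by (intro mult_le_mono) auto
  ultimately show "coeff (NFsum t d m) i = 0" by (intro coeff_NFsum_eq_0) auto
qed

lemma sum_higher_deriv_NFsum:
  assumes g: "g \<in> kerL0 r a"
  shows "(\<Sum>k\<le>d. t k * (deriv ^^ k) g y) = (\<Sum>m<r. poly (NFsum t d m) y * (deriv ^^ m) g y)"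
proof -
  have "t k * (deriv ^^ k) g y = (\<Sum>m<r. t k * poly (NF k m) y * (deriv ^^ m) g y)" for k
    using arg_cong[OF higher_deriv_NF[OF g, of k y], of "(*) (t k)"]
    by (simp only: sum_distrib_left mult.assoc)
  then have "(\<Sum>k\<le>d. t k * (deriv ^^ k) g y) = (\<Sum>k\<le>d. \<Sum>m<r. t k * poly (NF k m) y * (deriv ^^ m) g y)"
    by (rule sum.cong[OF refl])
  also have "\<dots> = (\<Sum>m<r. \<Sum>k\<le>d. t k * poly (NF k m) y * (deriv ^^ m) g y)"
    by (rule sum.swap)
  finally show ?thesis
    by (simp add: NFsum_def poly_sum sum_distrib_right)
qed

text \<open>Triangularity with respect to weight: t_d is the entry at m = d mod r, e = d div r, so
  the coefficients can be stripped off from the top.\<close>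

lemma NFsum_eq_0_imp:
  assumes "\<And>m. m < r \<Longrightarrow> NFsum t d m = 0" "k \<le> d"
  shows "t k = 0"
  using assms
proof (induction d)
  case 0
  then show ?case using coeff_NFsum_top[of 0 0 0 t] r by simp
next
  case (Suc d)
  have t: "t (Suc d) = 0"
    using coeff_NFsum_top[of "Suc d mod r" "Suc d div r" "Suc d" t] Suc.prems(1) r by simp
  then have "NFsum t (Suc d) m = NFsum t d m" for m
    by (simp add: NFsum_def)
  then show ?case using Suc t by (cases "k = Suc d") auto
qed

text \<open>Since the Wronskian is nonzero at y, the jets of order below r of the f_j at y span the
  whole space. This turns identities tested on all f_j into identities between coefficients.\<close>

lemma wronskian_vanish:
  assumes "\<And>j. j < r \<Longrightarrow> (\<Sum>m<r. v m * (deriv ^^ m) (f j) y) = 0" "m < r"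
  shows "v m = 0"
proof (rule ccontr)
  assume "v m \<noteq> 0"
  then have "wronsk f r y = 0"
    unfolding wronsk_def det_eq_0_iff_row_null using assms by (intro exI[of _ v]) auto
  then show False using wronsk_f[of y] by simp
qed

section \<open>Operators determined by their action on the translates f_j(x+z)\<close>

lemma wact_shift_NF:
  assumes g: "g \<in> kerL0 r a" and "degree T \<le> d"
  shows "wact T (\<lambda>x. g (x + z)) x
    = (\<Sum>m<r. poly (pcompose (NFsum (\<lambda>k. poly (coeff T k) x) d m) [:x, 1:]) z * (deriv ^^ m) g (x + z))"
  using sum_higher_deriv_NFsum[OF g, where t = "\<lambda>k. poly (coeff T k) x" and d = d and y = "x + z"] assms
  by (simp add: wact_bound[of T d] higher_deriv_shift poly_pcompose)

text \<open>\<open>wronskian_vanish\<close> at y = x + z fixes the r coefficients for every z, hence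
  as polynomials in z. The dependence of \<open>H\<close> on x is arbitrary, so any closed formula
  for T on the f_j(x+z) may be plugged in.\<close>

lemma wact_coeff_unique:
  assumes T: "\<And>j x z. j < r \<Longrightarrow> wact T (\<lambda>x. f j (x + z)) x = (\<Sum>m<r. poly (H m x) z * (deriv ^^ m) (f j) (x + z))"
    and "degree T \<le> d" "m < r"
  shows "H m x = pcompose (NFsum (\<lambda>k. poly (coeff T k) x) d m) [:x, 1:]"
proof -
  let ?P = "\<lambda>m. pcompose (NFsum (\<lambda>k. poly (coeff T k) x) d m) [:x, 1:]"
  have "poly (H m x - ?P m) z = 0" for z
  proof (rule wronskian_vanish[of "\<lambda>m. poly (H m x - ?P m) z" "x + z", OF _ \<open>m < r\<close>])
    fix j assume "j < r"
    then show "(\<Sum>m<r. poly (H m x - ?P m) z * (deriv ^^ m) (f j) (x + z)) = 0"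
      using T[of j z x] wact_shift_NF[OF f_ker \<open>degree T \<le> d\<close>, of j z x]
      by (simp add: left_diff_distrib sum_subtractf)
  qed
  then show ?thesis
    by (metis eq_iff_diff_eq_0 poly_all_0_iff_0)
qed

text \<open>The order of an operator is the highest weight in its normal form, so a bound is
  obtained without expanding the powers of L_0.\<close>

lemma degree_weyl_le:
  assumes T: "\<And>j x z. j < r \<Longrightarrow> wact T (\<lambda>x. f j (x + z)) x = (\<Sum>m<r. poly (H m x) z * (deriv ^^ m) (f j) (x + z))"
    and H: "\<And>m x e. m < r \<Longrightarrow> N < r * e + m \<Longrightarrow> coeff (H m x) e = 0"
  shows "degree T \<le> N"
proof (rule ccontr)
  assume *: "\<not> degree T \<le> N"
  define d where "d = degree T"
  have "coeff T d \<noteq> 0" using * by (auto simp: d_def)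
  then obtain x where x: "poly (coeff T d) x \<noteq> 0" using poly_all_0_iff_0 by blast
  define m e where "m = d mod r" and "e = d div r"
  have me: "m < r" "r * e + m = d" using r by (auto simp: m_def e_def)
  have "coeff (H m x) e = coeff (NFsum (\<lambda>k. poly (coeff T k) x) d m) e"
    using me r by (subst wact_coeff_unique[OF T, of d]) (auto simp: d_def intro!: coeff_pcompose_linear_top degree_NFsum)
  also have "\<dots> = poly (coeff T d) x"
    by (rule coeff_NFsum_top[OF me])
  finally show False using x H[of m e x] me * by (simp add: d_def)
qed

lemma coeff_weyl_top:
  assumes T: "\<And>j x z. j < r \<Longrightarrow> wact T (\<lambda>x. f j (x + z)) x = (\<Sum>m<r. poly (H m x) z * (deriv ^^ m) (f j) (x + z))"
    and "degree T \<le> r * n"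
  shows "poly (coeff T (r * n)) x = coeff (H 0 x) n"
  using assms(2) r
  by (subst wact_coeff_unique[OF T assms(2)])
     (auto simp: coeff_pcompose_linear_top degree_NFsum coeff_NFsum_top)

text \<open>The weight r n - 1 is r (n - 1) + (r - 1), hence the position m = r - 1, e = n -
  1.\<close>

lemma coeff_weyl_subtop:
  assumes T: "\<And>j x z. j < r \<Longrightarrow> wact T (\<lambda>x. f j (x + z)) x = (\<Sum>m<r. poly (H m x) z * (deriv ^^ m) (f j) (x + z))"
    and "degree T \<le> r * n" "n \<ge> 1"
  shows "poly (coeff T (r * n - 1)) x = coeff (H (r - 1) x) (n - 1)"
proof -
  obtain n' where n': "n = Suc n'" using assms(3) by (cases n) auto
  have "coeff (H (r - 1) x) n' = coeff (NFsum (\<lambda>k. poly (coeff T k) x) (r * n) (r - 1)) n'"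
    using r n' by (subst wact_coeff_unique[OF T assms(2)])
      (auto intro!: coeff_pcompose_linear_top degree_NFsum)
  also have "\<dots> = poly (coeff T (r * n - 1)) x"
    using r n' by (intro coeff_NFsum_subtop) auto
  finally show ?thesis using n' by simp
qed

text \<open>A single f_j does not separate operators, as L_0 kills it; all its translates together
  with those of the other basis functions do. Equalities in the Weyl algebra are checked on
  them.\<close>

lemma weyl_eq_0I:
  assumes "\<And>j x z. j < r \<Longrightarrow> wact T (\<lambda>x. f j (x + z)) x = 0"
  shows "T = 0"
proof (rule ccontr)
  assume "T \<noteq> 0"
  have T: "wact T (\<lambda>x. f j (x + z)) x = (\<Sum>m<r. poly ((\<lambda>_ _. 0) m x) z * (deriv ^^ m) (f j) (x + z))"
    if "j < r" for j x z using assms[OF that] by simp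
  have d: "degree T \<le> r * 0" by (rule degree_weyl_le[OF T]) auto
  then have "poly (coeff T 0) x = 0" for x
    using coeff_weyl_top[OF T, of 0 x] by simp
  then have "coeff T 0 = 0" using poly_all_0_iff_0 by blast
  then show False using d \<open>T \<noteq> 0\<close> by (metis le_zero_eq leading_coeff_0_iff mult_0_right)
qed

lemma weyl_eqI:
  assumes "\<And>j x z. j < r \<Longrightarrow> wact A (\<lambda>x. f j (x + z)) x = wact B (\<lambda>x. f j (x + z)) x"
  shows "A = B"
  using weyl_eq_0I[of "A - B"] assms by (simp add: wact_diff)

subsection \<open>The anti-automorphism\<close>

lemma wact_L0w_shift:
  assumes g: "g \<in> kerL0 r a"
  shows "wact (L0w r a) (\<lambda>x. g (x + z)) x = z * g (x + z)"
  using kerL0_deriv_r[OF g, of "x + z"]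
  by (simp add: wact_L0w higher_deriv_shift algebra_simps)

lemma wact_wpow_shift:
  assumes g: "g \<in> kerL0 r a"
  shows "wact (wpow (L0w r a) j) (\<lambda>x. g (x + z)) x = z ^ j * g (x + z)"
proof (induction j arbitrary: x)
  case 0
  then show ?case by (simp add: wpow_def wact_1)
next
  case (Suc j)
  have e: "entire (\<lambda>x. g (x + z))" using g by (intro entire_shift kerL0_entire)
  have "wact (wpow (L0w r a) j) (\<lambda>x. g (x + z)) = (\<lambda>x. z ^ j * g (x + z))"
    using Suc by blast
  then have "wact (wpow (L0w r a) (Suc j)) (\<lambda>x. g (x + z)) x = wact (L0w r a) (\<lambda>x. z ^ j * g (x + z)) x"
    using wact_wmult[OF e, of "L0w r a" "wpow (L0w r a) j" x] by (simp add: wpow_def)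
  then show ?case
    by (simp add: wact_cmult[OF e] wact_L0w_shift[OF g])
qed

lemma wact_pL0_shift:
  assumes g: "g \<in> kerL0 r a"
  shows "wact (pL0 r a p) (\<lambda>x. g (x + z)) = (\<lambda>x. poly p z * g (x + z))"
  by (simp add: fun_eq_iff pL0_def wact_sum wact_smult wact_wpow_shift[OF g] poly_altdef sum_distrib_right mult.assoc)

lemma wact_monom_pL0_shift:
  assumes g: "g \<in> kerL0 r a"
  shows "wact (wmult (monom 1 k) (pL0 r a p)) (\<lambda>x. g (x + z)) x = poly p z * (deriv ^^ k) g (x + z)"
proof -
  have e: "entire (\<lambda>x. g (x + z))" using g by (intro entire_shift kerL0_entire)
  then show ?thesis
    by (simp add: wact_wmult wact_pL0_shift[OF g] wact_monom higher_deriv_cmult_entire higher_deriv_shift)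
qed

text \<open>L_0 in x acts on g(x+z) as multiplication by z. Together with \<open>weyl_eqI\<close>
  this characterizes flat: the image of an operator is found by exchanging x and z in its
  action.\<close>

lemma wact_wflat_shift:
  assumes g: "g \<in> kerL0 r a"
  shows "wact (wflat r a T) (\<lambda>x. g (x + z)) x = wact T (\<lambda>z. g (x + z)) z"
  by (simp add: wflat_def wact_sum wact_monom_pL0_shift[OF g] wact_def[of T] higher_deriv_shift')

end

subsection \<open>Calogero--Moser matrices\<close>

lemma sum_delta_left:
  fixes F :: "nat \<Rightarrow> 'b :: comm_ring_1"
  assumes "i < n"
  shows "(\<Sum>k<n. (if i = k then c k else 0) * F k) = c i * F i"
    and "(\<Sum>k<n. (if k = i then c k else 0) * F k) = c i * F i"
    and "(\<Sum>k<n. F k * (if i = k then c k else 0)) = F i * c i"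
    and "(\<Sum>k<n. F k * (if k = i then c k else 0)) = F i * c i"
  using assms by (simp_all add: if_distrib[of "\<lambda>x. x * _"] if_distrib[of "\<lambda>x. _ * x"] cong: if_cong)

locale airy_nodes = airy +
  fixes n :: nat and lam gam :: "nat \<Rightarrow> complex"
  assumes n: "n \<ge> 1" and inj: "inj_on lam {..<n}"
begin

definition q :: "complex poly" where "q = (\<Prod>i<n. [:- lam i, 1:])"

definition qi :: "nat \<Rightarrow> complex poly" where "qi i = (\<Prod>j\<in>{..<n} - {i}. [:- lam j, 1:])"

lemma q_eq: "i < n \<Longrightarrow> q = [:- lam i, 1:] * qi i"
  unfolding q_def qi_def by (subst prod.remove[of _ i]) auto

lemma monic_q: "lead_coeff q = 1"
  unfolding q_def lead_coeff_prod by simp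

lemma degree_q: "degree q = n"
  by (simp add: q_def degree_prod_eq_sum_degree)

lemma monic_qi: "lead_coeff (qi i) = 1"
  unfolding qi_def lead_coeff_prod by simp

lemma degree_qi: "i < n \<Longrightarrow> degree (qi i) = n - 1"
  by (simp add: qi_def degree_prod_eq_sum_degree)

lemma coeff_qi_top: "i < n \<Longrightarrow> coeff (qi i) (n - 1) = 1"
  using monic_qi[of i] by (simp add: degree_qi)

lemma poly_q_lam: "i < n \<Longrightarrow> poly q (lam i) = 0"
  by (simp add: q_eq)

lemma poly_qi_other: "i < n \<Longrightarrow> j < n \<Longrightarrow> i \<noteq> j \<Longrightarrow> poly (qi j) (lam i) = 0"
  by (auto simp: qi_def poly_prod intro!: prod_zero)

lemma poly_qi_self: "i < n \<Longrightarrow> poly (qi i) (lam i) \<noteq> 0"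
  using inj by (auto simp: qi_def poly_prod inj_on_def)

lemma pderiv_q: "pderiv q = (\<Sum>i<n. qi i)"
  unfolding q_def qi_def by (subst pderiv_prod) (simp add: pderiv_pCons)

lemma pderiv_q_eq:
  assumes "i < n"
  shows "poly (pderiv q) x = poly (qi i) x + (x - lam i) * poly (pderiv (qi i)) x"
  unfolding q_eq[OF assms] pderiv_mult by (simp add: pderiv_pCons algebra_simps)

lemma pderiv_q_lam: "i < n \<Longrightarrow> poly (pderiv q) (lam i) = poly (qi i) (lam i)"
  by (simp add: pderiv_q_eq)

lemma poly_q_eq_0_iff: "poly q x = 0 \<longleftrightarrow> x \<in> lam ` {..<n}"
  by (auto simp: q_def poly_prod)

text \<open>Differentiation in the basis \<open>qi j\<close>, evaluated at \<open>lam i\<close> and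
  divided by \<open>poly (qi i) (lam i)\<close>, plus gam on the diagonal (see
  \<open>sum_pderiv_qi\<close>). On the diagonal q'' = 2 qi' and q' = qi at \<open>lam i\<close>,
  which is the form in the overview.\<close>

definition M :: "nat \<Rightarrow> nat \<Rightarrow> complex" where
  "M i j = poly (pderiv (qi j)) (lam i) / poly (qi i) (lam i) + (if i = j then gam i else 0)"

text \<open>The relation ZM - MZ = 11^T - 1. Off the diagonal it compares the values of q'(lam i)
  obtained by splitting off the factor at i and the factor at j.\<close>

lemma M_cm:
  assumes "i < n" "j < n"
  shows "(lam i - lam j) * M i j = (if i = j then 0 else 1)"
proof (cases "i = j")
  case False
  have "poly (pderiv q) (lam i) = (lam i - lam j) * poly (pderiv (qi j)) (lam i)"
    using assms False by (simp add: pderiv_q_eq[of j] poly_qi_other)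
  then show ?thesis
    using assms False poly_qi_self[of i] pderiv_q_lam[of i] by (simp add: M_def)
qed simp

text \<open>Here \<open>R s\<close> is $p_{r-1-s}(-M)$, so that \<open>R r\<close> is $p(-M)$.\<close>

primrec R :: "nat \<Rightarrow> nat \<Rightarrow> nat \<Rightarrow> complex" where
  "R 0 = (\<lambda>i j. if i = j then 1 else 0)"
| "R (Suc s) = (\<lambda>i j. - (\<Sum>k<n. M i k * R s k j) - (if i = j then ac (r - 1 - s) else 0))"

lemma R_commute:
  "i < n \<Longrightarrow> j < n \<Longrightarrow> (\<Sum>k<n. M i k * R s k j) = (\<Sum>k<n. R s i k * M k j)"
proof (induction s arbitrary: i j)
  case 0
  then show ?case by (simp add: sum_delta_left)
next
  case (Suc s)
  let ?c = "ac (r - 1 - s)"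
  have "(\<Sum>k<n. M i k * R (Suc s) k j)
      = - (\<Sum>k<n. M i k * (\<Sum>l<n. M k l * R s l j)) - (\<Sum>k<n. M i k * (if k = j then ?c else 0))"
    by (simp add: right_diff_distrib sum_subtractf sum_negf)
  also have "(\<Sum>k<n. M i k * (\<Sum>l<n. M k l * R s l j)) = (\<Sum>k<n. M i k * (\<Sum>l<n. R s k l * M l j))"
    using Suc.IH[OF _ Suc.prems(2)] by simp
  also have "\<dots> = (\<Sum>l<n. (\<Sum>k<n. M i k * R s k l) * M l j)"
    unfolding sum_distrib_left sum_distrib_right
    by (subst sum.swap) (simp add: mult.assoc)
  also have "(\<Sum>k<n. M i k * (if k = j then ?c else 0)) = (\<Sum>l<n. (if i = l then ?c else 0) * M l j)"
    using Suc.prems sum_delta_left(4)[of j n "M i" "\<lambda>_. ?c"] sum_delta_left(1)[of i n "\<lambda>_. ?c" "\<lambda>l. M l j"]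
    by simp
  finally show ?case
    by (simp add: left_diff_distrib sum_subtractf sum_negf)
qed

definition X :: "nat \<Rightarrow> nat \<Rightarrow> complex" where
  "X i j = R r i j - (if i = j then lam i else 0)"

definition Y :: "complex \<Rightarrow> nat \<Rightarrow> nat \<Rightarrow> complex" where
  "Y x i j = (if i = j then x else 0) - X i j"

text \<open>Y = (x + Z) - p(-M), and p(-M) commutes with M, so [Y, M] = [Z, M] and
  \<open>M_cm\<close> applies.\<close>

lemma Y_commutator:
  assumes "i < n" "j < n"
  shows "(\<Sum>k<n. Y x i k * M k j) - (\<Sum>k<n. M i k * Y x k j) = (if i = j then 0 else 1)"
proof -
  have "(\<Sum>k<n. Y x i k * M k j) = (\<Sum>k<n. (if i = k then x + lam i else 0) * M k j) - (\<Sum>k<n. R r i k * M k j)"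
    by (simp add: Y_def X_def sum_subtractf[symmetric] left_diff_distrib[symmetric])
       (rule sum.cong, auto simp: algebra_simps)
  moreover have "(\<Sum>k<n. M i k * Y x k j) = (\<Sum>k<n. M i k * (if k = j then x + lam k else 0)) - (\<Sum>k<n. M i k * R r k j)"
    by (simp add: Y_def X_def sum_subtractf[symmetric] right_diff_distrib[symmetric])
       (rule sum.cong, auto simp: algebra_simps)
  ultimately show ?thesis
    using M_cm[OF assms] assms
    by (simp only: R_commute[OF assms] sum_delta_left) (auto simp: algebra_simps)
qed

lemma Y_commutator_apply:
  assumes "i < n"
  shows "(\<Sum>k<n. Y x i k * (\<Sum>j<n. M k j * v j)) - (\<Sum>k<n. M i k * (\<Sum>j<n. Y x k j * v j))
    = (\<Sum>j<n. v j) - v i"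
proof -
  have "(\<Sum>k<n. Y x i k * (\<Sum>j<n. M k j * v j)) = (\<Sum>j<n. (\<Sum>k<n. Y x i k * M k j) * v j)"
    unfolding sum_distrib_left sum_distrib_right by (subst sum.swap) (simp add: mult.assoc)
  moreover have "(\<Sum>k<n. M i k * (\<Sum>j<n. Y x k j * v j)) = (\<Sum>j<n. (\<Sum>k<n. M i k * Y x k j) * v j)"
    unfolding sum_distrib_left sum_distrib_right by (subst sum.swap) (simp add: mult.assoc)
  ultimately have "(\<Sum>k<n. Y x i k * (\<Sum>j<n. M k j * v j)) - (\<Sum>k<n. M i k * (\<Sum>j<n. Y x k j * v j))
    = (\<Sum>j<n. ((\<Sum>k<n. Y x i k * M k j) - (\<Sum>k<n. M i k * Y x k j)) * v j)"
    by (simp add: left_diff_distrib sum_subtractf)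
  also have "\<dots> = (\<Sum>j<n. v j - (if i = j then 1 else 0) * v j)"
    using assms by (intro sum.cong refl) (simp add: Y_commutator)
  finally show ?thesis
    using assms sum_delta_left(1)[of i n "\<lambda>_. 1" v] by (simp add: sum_subtractf)
qed

section \<open>The adjugate of x - X and the vector w = adj(x - X) 1\<close>

definition Xmat :: "complex mat" where "Xmat = mat n n (\<lambda>(i, j). X i j)"

definition tau_X :: "complex poly" where "tau_X = char_poly Xmat"

definition Adj :: "nat \<Rightarrow> nat \<Rightarrow> complex poly" where
  "Adj i j = adj_mat (char_poly_matrix Xmat) $$ (i, j)"

lemma Xmat_carrier: "Xmat \<in> carrier_mat n n"
  by (simp add: Xmat_def)

lemma monic_tau_X: "lead_coeff tau_X = 1" and degree_tau_X: "degree tau_X = n"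
  using degree_monic_char_poly[OF Xmat_carrier] by (simp_all add: tau_X_def)

lemma poly_char_poly_matrix:
  "i < n \<Longrightarrow> j < n \<Longrightarrow> poly (char_poly_matrix Xmat $$ (i, j)) x = Y x i j"
  by (simp add: char_poly_matrix_def Xmat_def Y_def)

lemma Y_Adj:
  assumes "i < n" "j < n"
  shows "(\<Sum>k<n. Y x i k * poly (Adj k j) x) = (if i = j then poly tau_X x else 0)"
proof -
  let ?C = "char_poly_matrix Xmat"
  have C: "?C \<in> carrier_mat n n" using Xmat_carrier by simp
  have "(?C * adj_mat ?C) $$ (i, j) = (if i = j then tau_X else 0)"
    using assms by (simp add: adj_mat(2)[OF C] tau_X_def char_poly_def)
  moreover have "(?C * adj_mat ?C) $$ (i, j) = (\<Sum>k<n. ?C $$ (i, k) * Adj k j)"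
    using assms C adj_mat(1)[OF C] by (simp add: times_mat_def scalar_prod_def atLeast0LessThan Adj_def)
  ultimately have "poly (\<Sum>k<n. ?C $$ (i, k) * Adj k j) x = (if i = j then poly tau_X x else 0)"
    by simp
  then show ?thesis using assms by (simp add: poly_sum poly_char_poly_matrix)
qed

lemma Adj_Y:
  assumes "i < n" "j < n"
  shows "(\<Sum>k<n. poly (Adj i k) x * Y x k j) = (if i = j then poly tau_X x else 0)"
proof -
  let ?C = "char_poly_matrix Xmat"
  have C: "?C \<in> carrier_mat n n" using Xmat_carrier by simp
  have "(adj_mat ?C * ?C) $$ (i, j) = (if i = j then tau_X else 0)"
    using assms by (simp add: adj_mat(3)[OF C] tau_X_def char_poly_def)
  moreover have "(adj_mat ?C * ?C) $$ (i, j) = (\<Sum>k<n. Adj i k * ?C $$ (k, j))"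
    using assms C adj_mat(1)[OF C] by (simp add: times_mat_def scalar_prod_def atLeast0LessThan Adj_def)
  ultimately have "poly (\<Sum>k<n. Adj i k * ?C $$ (k, j)) x = (if i = j then poly tau_X x else 0)"
    by simp
  then show ?thesis using assms by (simp add: poly_sum poly_char_poly_matrix)
qed

text \<open>Jacobi's formula: both sides are the sum of the characteristic polynomials of the
  principal submatrices of size n - 1.\<close>

lemma trace_Adj: "(\<Sum>i<n. Adj i i) = pderiv tau_X"
proof -
  let ?C = "char_poly_matrix Xmat"
  have "Adj i i = char_poly (mat_delete Xmat i i)" if i: "i < n" for i
  proof -
    have "mat_delete ?C i i = char_poly_matrix (mat_delete Xmat i i)"
      using i by (intro eq_matI) (auto simp: char_poly_matrix_def Xmat_def mat_delete_def)
    then show ?thesis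
      using i carrier_matD[OF char_poly_matrix_closed[OF Xmat_carrier]]
      by (simp add: Adj_def adj_mat_def cofactor_def char_poly_def flip: power_add mult_2)
  qed
  then show ?thesis
    unfolding tau_X_def pderiv_char_poly[OF Xmat_carrier] by simp
qed

text \<open>Compares the coefficients of x^(e+1) in (x - X) adj(x - X) = tau 1.\<close>

lemma Adj_recursion:
  assumes "i < n" "j < n"
  shows "coeff (Adj i j) e = (if i = j then coeff tau_X (Suc e) else 0) + (\<Sum>k<n. X i k * coeff (Adj k j) (Suc e))"
proof -
  have "poly ([:0, 1:] * Adj i j - (\<Sum>k<n. Polynomial.smult (X i k) (Adj k j))) x
      = poly (if i = j then tau_X else 0) x" for x
    using Y_Adj[OF assms, of x] assms sum_delta_left(1)[of i n "\<lambda>_. x" "\<lambda>k. poly (Adj k j) x"]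
    by (simp add: Y_def left_diff_distrib sum_subtractf poly_sum)
  then have "[:0, 1:] * Adj i j - (\<Sum>k<n. Polynomial.smult (X i k) (Adj k j)) = (if i = j then tau_X else 0)"
    by (simp add: poly_eq_poly_eq_iff[symmetric] fun_eq_iff)
  then have "coeff ([:0, 1:] * Adj i j - (\<Sum>k<n. Polynomial.smult (X i k) (Adj k j))) (Suc e)
     = coeff (if i = j then tau_X else 0) (Suc e)"
    by simp
  then show ?thesis by (simp add: coeff_sum algebra_simps split: if_splits)
qed

text \<open>Downward induction on e from the common degree bound \<open>B\<close>: for e >= n the
  recursion expresses coefficient e by the coefficients e + 1 alone, because tau has degree
  n.\<close>

lemma coeff_Adj_eq_0:
  assumes "i < n" "j < n" "e \<ge> n"
  shows "coeff (Adj i j) e = 0"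
proof -
  define B where "B = (\<Sum>i<n. \<Sum>j<n. degree (Adj i j))"
  have B: "degree (Adj i j) \<le> B" if "i < n" "j < n" for i j
  proof -
    have "degree (Adj i j) \<le> (\<Sum>j<n. degree (Adj i j))"
      using that by (intro member_le_sum) auto
    also have "\<dots> \<le> B"
      unfolding B_def using that by (intro member_le_sum[of i "{..<n}" "\<lambda>i. \<Sum>j<n. degree (Adj i j)"]) auto
    finally show ?thesis .
  qed
  show ?thesis
    using assms
  proof (induction "Suc B - e" arbitrary: e i)
    case 0
    then show ?case using B[of i j] by (intro coeff_eq_0) auto
  next
    case (Suc d)
    have "coeff (Adj k j) (Suc e) = 0" if "k < n" for k
      using Suc.hyps(2) Suc.prems that by (intro Suc.hyps(1)) auto
    moreover have "coeff tau_X (Suc e) = 0"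
      using Suc.prems degree_tau_X by (intro coeff_eq_0) auto
    ultimately show ?case
      unfolding Adj_recursion[OF Suc.prems(1,2)] by simp
  qed
qed

lemma coeff_Adj_top:
  assumes "i < n" "j < n"
  shows "coeff (Adj i j) (n - 1) = (if i = j then 1 else 0)"
  using assms Adj_recursion[OF assms, of "n - 1"] coeff_Adj_eq_0[OF _ assms(2), of _ n]
    monic_tau_X degree_tau_X by simp

definition w :: "nat \<Rightarrow> complex poly" where "w i = (\<Sum>j<n. Adj i j)"

lemma coeff_w_top:
  assumes "i < n" shows "coeff (w i) (n - 1) = 1"
proof -
  have "coeff (w i) (n - 1) = (\<Sum>j<n. (if i = j then 1 else 0) * 1)"
    unfolding w_def coeff_sum using assms by (intro sum.cong) (use coeff_Adj_top in auto)
  then show ?thesis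
    using sum_delta_left(1)[OF assms, of "\<lambda>_. 1::complex" "\<lambda>_. 1"] by simp
qed

lemma degree_w: "i < n \<Longrightarrow> degree (w i) \<le> n - 1"
  by (intro degree_le allI impI) (auto simp: w_def coeff_sum coeff_Adj_eq_0 intro!: sum.neutral)

lemma Y_w:
  assumes "i < n" shows "(\<Sum>k<n. Y x i k * poly (w k) x) = poly tau_X x"
proof -
  have "(\<Sum>k<n. Y x i k * poly (w k) x) = (\<Sum>j<n. \<Sum>k<n. Y x i k * poly (Adj k j) x)"
    unfolding w_def poly_sum sum_distrib_left by (rule sum.swap)
  also have "\<dots> = (\<Sum>j<n. (if i = j then poly tau_X x else 0) * 1)"
    using assms by (simp add: Y_Adj)
  finally show ?thesis
    using sum_delta_left(1)[OF assms, of "\<lambda>_. poly tau_X x" "\<lambda>_. 1"] by simp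
qed

text \<open>The trace of \<open>Adj * ([Y, M] + 1)\<close>, where \<open>[Y, M] + 1\<close> has all entries 1.\<close>

lemma sum_w: "(\<Sum>i<n. w i) = pderiv tau_X"
proof -
  have "poly (\<Sum>i<n. w i) x = poly (\<Sum>i<n. Adj i i) x" for x
  proof -
    define A where "A i j = poly (Adj i j) x" for i j
    have "(\<Sum>i<n. \<Sum>j<n. A i j) - (\<Sum>i<n. A i i)
       = (\<Sum>i<n. \<Sum>j<n. A i j * ((\<Sum>k<n. Y x j k * M k i) - (\<Sum>k<n. M j k * Y x k i)))"
    proof -
      have "(\<Sum>j<n. A i j) - A i i = (\<Sum>j<n. A i j * ((\<Sum>k<n. Y x j k * M k i) - (\<Sum>k<n. M j k * Y x k i)))"
        if "i < n" for i
      proof -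
        have "(\<Sum>j<n. A i j) - A i i = (\<Sum>j<n. A i j - A i j * (if j = i then 1 else 0))"
          using that by (simp add: sum_subtractf sum_delta_left)
        also have "\<dots> = (\<Sum>j<n. A i j * ((\<Sum>k<n. Y x j k * M k i) - (\<Sum>k<n. M j k * Y x k i)))"
          using that by (intro sum.cong refl) (simp add: Y_commutator)
        finally show ?thesis .
      qed
      then show ?thesis by (simp add: sum_subtractf[symmetric])
    qed
    \<comment> \<open>These are tr(Adj Y M) and tr(Adj M Y). Both reduce to tau tr M, the second
      after a cyclic rotation, so the difference vanishes.\<close>
    also have "\<dots> = (\<Sum>i<n. \<Sum>j<n. \<Sum>k<n. A i j * (Y x j k * M k i)) - (\<Sum>i<n. \<Sum>j<n. \<Sum>k<n. A i j * (M j k * Y x k i))"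
      by (simp add: right_diff_distrib sum_subtractf sum_distrib_left)
    also have "(\<Sum>i<n. \<Sum>j<n. \<Sum>k<n. A i j * (Y x j k * M k i)) = (\<Sum>i<n. \<Sum>k<n. (\<Sum>j<n. A i j * Y x j k) * M k i)"
      unfolding sum_distrib_right
      by (rule sum.cong[OF refl], subst sum.swap) (simp add: mult.assoc)
    also have "\<dots> = (\<Sum>i<n. poly tau_X x * M i i)"
      unfolding A_def by (intro sum.cong refl) (simp add: Adj_Y sum_delta_left)
    also have "(\<Sum>i<n. \<Sum>j<n. \<Sum>k<n. A i j * (M j k * Y x k i)) = (\<Sum>j<n. \<Sum>k<n. M j k * (\<Sum>i<n. Y x k i * A i j))"
    proof -
      have "(\<Sum>i<n. \<Sum>j<n. \<Sum>k<n. A i j * (M j k * Y x k i)) = (\<Sum>j<n. \<Sum>i<n. \<Sum>k<n. A i j * (M j k * Y x k i))"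
        by (rule sum.swap)
      also have "\<dots> = (\<Sum>j<n. \<Sum>k<n. \<Sum>i<n. A i j * (M j k * Y x k i))"
        by (intro sum.cong refl sum.swap)
      finally show ?thesis by (simp add: sum_distrib_left mult_ac)
    qed
    also have "\<dots> = (\<Sum>j<n. poly tau_X x * M j j)"
      unfolding A_def by (intro sum.cong refl) (simp add: Y_Adj sum_delta_left)
    finally show ?thesis by (simp add: A_def w_def poly_sum)
  qed
  then have "(\<Sum>i<n. w i) = (\<Sum>i<n. Adj i i)"
    by (simp add: poly_eq_poly_eq_iff[symmetric] fun_eq_iff)
  then show ?thesis by (simp add: trace_Adj)
qed

text \<open>The vector p_m(-M) w; entry i multiplies \<open>qi i\<close> in the coefficient of the
  m-th derivative, with a minus sign.\<close>

definition u :: "nat \<Rightarrow> nat \<Rightarrow> complex poly" where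
  "u m i = (\<Sum>j<n. Polynomial.smult (R (r - 1 - m) i j) (w j))"

lemma degree_u: "degree (u m i) \<le> n - 1"
  unfolding u_def using degree_w by (intro degree_sum_le) (auto intro: order.trans[OF degree_smult_le])

lemma u_last: "i < n \<Longrightarrow> poly (u (r - 1) i) x = poly (w i) x"
  by (simp add: u_def poly_sum sum_delta_left)

lemma R_Suc_apply:
  assumes "i < n"
  shows "(\<Sum>j<n. R (Suc s) i j * v j) = - (\<Sum>k<n. M i k * (\<Sum>j<n. R s k j * v j)) - ac (r - 1 - s) * v i"
proof -
  have "(\<Sum>j<n. R (Suc s) i j * v j)
     = - (\<Sum>j<n. \<Sum>k<n. M i k * R s k j * v j) - (\<Sum>j<n. (if i = j then ac (r - 1 - s) else 0) * v j)"
    by (simp add: left_diff_distrib sum_subtractf sum_negf sum_distrib_right)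
  also have "(\<Sum>j<n. \<Sum>k<n. M i k * R s k j * v j) = (\<Sum>k<n. M i k * (\<Sum>j<n. R s k j * v j))"
    unfolding sum_distrib_left by (subst sum.swap) (simp add: mult.assoc)
  finally show ?thesis using assms by (simp add: sum_delta_left)
qed

text \<open>Horner's step. Read as equations for u, this and \<open>u_0\<close> are the conditions
  for annihilation at \<open>lam i\<close>, in the orders m > 0 and m = 0.\<close>

lemma u_pred:
  assumes "i < n" "m < r" "m \<noteq> 0"
  shows "poly (u (m - 1) i) x = - (\<Sum>k<n. M i k * poly (u m k) x) - ac m * poly (w i) x"
proof -
  have "r - 1 - (m - 1) = Suc (r - 1 - m)" "r - 1 - (r - 1 - m) = m" using assms by auto
  then show ?thesis
    using R_Suc_apply[OF assms(1), of "r - 1 - m" "\<lambda>j. poly (w j) x"]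
    by (simp only: u_def poly_sum poly_smult)
qed

lemma u_0:
  assumes "i < n"
  shows "(\<Sum>k<n. M i k * poly (u 0 k) x) + (x + lam i) * poly (w i) x = poly tau_X x"
proof -
  have "(\<Sum>j<n. R r i j * poly (w j) x) = - (\<Sum>k<n. M i k * poly (u 0 k) x)"
    using R_Suc_apply[OF assms, of "r - 1" "\<lambda>j. poly (w j) x"] r by (simp add: u_def poly_sum)
  moreover have "(\<Sum>j<n. Y x i j * poly (w j) x) = (\<Sum>j<n. (if i = j then x + lam i else 0) * poly (w j) x) - (\<Sum>j<n. R r i j * poly (w j) x)"
    unfolding sum_subtractf[symmetric] by (intro sum.cong refl) (auto simp: Y_def X_def algebra_simps)
  ultimately show ?thesis using assms Y_w[OF assms, of x] by (simp add: sum_delta_left)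
qed

lemma Y_nonsingular:
  assumes "poly tau_X x \<noteq> 0" "\<And>i. i < n \<Longrightarrow> (\<Sum>k<n. Y x i k * v k) = 0" "i < n"
  shows "v i = 0"
proof -
  have "0 = (\<Sum>j<n. poly (Adj i j) x * (\<Sum>k<n. Y x j k * v k))"
    using assms(2) by simp
  also have "\<dots> = (\<Sum>k<n. (\<Sum>j<n. poly (Adj i j) x * Y x j k) * v k)"
    unfolding sum_distrib_left sum_distrib_right by (subst sum.swap) (simp add: mult.assoc)
  also have "\<dots> = poly tau_X x * v i"
    using assms(3) by (simp add: Adj_Y sum_delta_left)
  finally show ?thesis using assms(1) by simp
qed

text \<open>Adj v is evaluated twice. From Yv = 0 the commutator gives Y M v = (sum v) 1 - v, and
  Adj Y = 0 at the root yields Adj v = (sum v) w. Differentiating Adj Y = tau gives Adj v = tau' v.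
  So at a simple root the kernel is spanned by w.\<close>

lemma Y_kernel:
  assumes root: "poly tau_X x = 0" and v: "\<And>i. i < n \<Longrightarrow> (\<Sum>k<n. Y x i k * v k) = 0" and i: "i < n"
  shows "poly (pderiv tau_X) x * v i = (\<Sum>j<n. v j) * poly (w i) x"
proof -
  define v' where "v' k = (\<Sum>j<n. M k j * v j)" for k
  have "(\<Sum>k<n. Y x j k * v' k) = (\<Sum>j<n. v j) - v j" if "j < n" for j
    using Y_commutator_apply[OF that, of x v] v by (simp add: v'_def)
  then have "(\<Sum>j<n. poly (Adj i j) x * (\<Sum>k<n. Y x j k * v' k))
      = (\<Sum>j<n. poly (Adj i j) x * ((\<Sum>j<n. v j) - v j))"
    by simp
  moreover have "(\<Sum>j<n. poly (Adj i j) x * (\<Sum>k<n. Y x j k * v' k)) = (\<Sum>k<n. (\<Sum>j<n. poly (Adj i j) x * Y x j k) * v' k)"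
    unfolding sum_distrib_left sum_distrib_right by (subst sum.swap) (simp add: mult.assoc)
  moreover have "\<dots> = 0"
    using i sum_delta_left(1)[OF i, of "\<lambda>_. poly tau_X x" v'] by (simp add: Adj_Y) (simp add: root)
  ultimately have "(\<Sum>j<n. poly (Adj i j) x * ((\<Sum>j<n. v j) - v j)) = 0" by simp
  then have 1: "(\<Sum>j<n. poly (Adj i j) x * v j) = (\<Sum>j<n. v j) * poly (w i) x"
    unfolding right_diff_distrib sum_subtractf sum_distrib_right[symmetric]
    by (simp add: w_def poly_sum mult.commute)
  \<comment> \<open>The x-derivative of Adj Y = tau, in which Y has derivative 1; applied to v, only
    the term Adj v survives on the left.\<close>
  have "(\<Sum>k<n. poly (pderiv (Adj i k)) x * Y x k j) + poly (Adj i j) x = (if i = j then poly (pderiv tau_X) x else 0)"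
    if "j < n" for j
  proof -
    have poly_if: "((\<lambda>x. if i = j then poly tau_X x else 0) has_field_derivative (if i = j then poly (pderiv tau_X) x else 0)) (at x)"
      by (auto intro: poly_DERIV)
    have "((\<lambda>x. \<Sum>k<n. poly (Adj i k) x * Y x k j) has_field_derivative
       (\<Sum>k<n. poly (Adj i k) x * (if k = j then 1 else 0) + poly (pderiv (Adj i k)) x * Y x k j)) (at x)"
      by (intro DERIV_sum DERIV_mult' poly_DERIV) (auto simp: Y_def intro!: derivative_eq_intros)
    moreover have "(\<lambda>x. \<Sum>k<n. poly (Adj i k) x * Y x k j) = (\<lambda>x. if i = j then poly tau_X x else 0)"
      by (rule ext) (rule Adj_Y[OF i that])
    ultimately have "((\<lambda>x. if i = j then poly tau_X x else 0) has_field_derivative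
       (\<Sum>k<n. poly (Adj i k) x * (if k = j then 1 else 0) + poly (pderiv (Adj i k)) x * Y x k j)) (at x)"
      by simp
    from DERIV_unique[OF this poly_if]
    have "(\<Sum>k<n. poly (Adj i k) x * (if k = j then 1 else 0) + poly (pderiv (Adj i k)) x * Y x k j)
       = (if i = j then poly (pderiv tau_X) x else 0)" .
    then show ?thesis using that by (simp add: sum.distrib sum_delta_left add.commute)
  qed
  then have "(\<Sum>j<n. (\<Sum>k<n. poly (pderiv (Adj i k)) x * Y x k j) * v j) + (\<Sum>j<n. poly (Adj i j) x * v j)
     = (\<Sum>j<n. (if i = j then poly (pderiv tau_X) x else 0) * v j)"
    unfolding sum.distrib[symmetric] distrib_right[symmetric] by simp
  moreover have "(\<Sum>j<n. (\<Sum>k<n. poly (pderiv (Adj i k)) x * Y x k j) * v j)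
    = (\<Sum>k<n. poly (pderiv (Adj i k)) x * (\<Sum>j<n. Y x k j * v j))"
    unfolding sum_distrib_left sum_distrib_right by (subst sum.swap) (simp add: mult.assoc)
  moreover have "\<dots> = 0" using v by simp
  ultimately have "(\<Sum>j<n. poly (Adj i j) x * v j) = poly (pderiv tau_X) x * v i"
    using i by (simp add: sum_delta_left)
  with 1 show ?thesis by simp
qed

text \<open>At a simple root the vector w' - M w lies in ker(x - X), hence is a multiple of w by
  \<open>Y_kernel\<close>; this is minus the factor, found by summing entries, as the entries of w
  sum to tau'.\<close>

definition gam_dual :: "complex \<Rightarrow> complex" where
  "gam_dual x = - (\<Sum>j<n. poly (pderiv (w j)) x - (\<Sum>k<n. M j k * poly (w k) x)) / poly (pderiv tau_X) x"

text \<open>Differentiating Y w = tau 1 gives Y w' = tau' 1 - w. The commutator applied to w gives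
  the same value for Y M w, since Y w = 0 at the root and the entries of w sum to tau'. So w' - M w
  is in the kernel.\<close>

lemma pderiv_w_root:
  assumes root: "poly tau_X x = 0" "poly (pderiv tau_X) x \<noteq> 0" and i: "i < n"
  shows "poly (pderiv (w i)) x = (\<Sum>k<n. M i k * poly (w k) x) - gam_dual x * poly (w i) x"
proof -
  define v where "v i = poly (pderiv (w i)) x - (\<Sum>k<n. M i k * poly (w k) x)" for i
  have "(\<Sum>k<n. Y x i k * v k) = 0" if "i < n" for i
  proof -
    have "((\<lambda>x. \<Sum>k<n. Y x i k * poly (w k) x) has_field_derivative
       (\<Sum>k<n. Y x i k * poly (pderiv (w k)) x + (if i = k then 1 else 0) * poly (w k) x)) (at x)"
      by (intro DERIV_sum DERIV_mult' poly_DERIV) (auto simp: Y_def intro!: derivative_eq_intros)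
    moreover have "(\<lambda>x. \<Sum>k<n. Y x i k * poly (w k) x) = poly tau_X"
      by (rule ext) (rule Y_w[OF that])
    ultimately have "(poly tau_X has_field_derivative
       (\<Sum>k<n. Y x i k * poly (pderiv (w k)) x + (if i = k then 1 else 0) * poly (w k) x)) (at x)"
      by simp
    from DERIV_unique[OF this poly_DERIV]
    have "(\<Sum>k<n. Y x i k * poly (pderiv (w k)) x + (if i = k then 1 else 0) * poly (w k) x) = poly (pderiv tau_X) x" .
    then have "(\<Sum>k<n. Y x i k * poly (pderiv (w k)) x) + poly (w i) x = poly (pderiv tau_X) x"
      using that by (simp add: sum.distrib sum_delta_left)
    then have "(\<Sum>k<n. Y x i k * poly (pderiv (w k)) x) = poly (pderiv tau_X) x - poly (w i) x"
      by (simp only: eq_diff_eq)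
    moreover have "(\<Sum>k<n. Y x i k * (\<Sum>j<n. M k j * poly (w j) x)) = poly (pderiv tau_X) x - poly (w i) x"
      using Y_commutator_apply[OF that, of x "\<lambda>j. poly (w j) x"] root
      by (simp add: Y_w sum_w[symmetric] poly_sum)
    ultimately show ?thesis
      by (simp add: v_def right_diff_distrib sum_subtractf)
  qed
  from Y_kernel[OF root(1) this i]
  have "v i = - gam_dual x * poly (w i) x"
    using root(2) by (simp add: gam_dual_def v_def field_simps)
  then show ?thesis by (simp add: v_def algebra_simps)
qed

text \<open>\<open>R\<close> does not depend on x and commutes with M, so the relation for w passes
  to u = R w.\<close>

lemma pderiv_u_root:
  assumes root: "poly tau_X x = 0" "poly (pderiv tau_X) x \<noteq> 0" and i: "i < n"
  shows "poly (pderiv (u m i)) x = (\<Sum>k<n. M i k * poly (u m k) x) - gam_dual x * poly (u m i) x"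
proof -
  let ?R = "R (r - 1 - m)"
  have "poly (pderiv (u m i)) x = (\<Sum>j<n. ?R i j * poly (pderiv (w j)) x)"
    by (simp add: u_def pderiv_sum pderiv_smult poly_sum)
  also have "\<dots> = (\<Sum>j<n. ?R i j * (\<Sum>k<n. M j k * poly (w k) x)) - gam_dual x * poly (u m i) x"
    using pderiv_w_root[OF root]
    by (simp add: right_diff_distrib sum_subtractf u_def poly_sum sum_distrib_left mult_ac)
  also have "(\<Sum>j<n. ?R i j * (\<Sum>k<n. M j k * poly (w k) x)) = (\<Sum>k<n. (\<Sum>j<n. ?R i j * M j k) * poly (w k) x)"
    unfolding sum_distrib_left sum_distrib_right by (subst sum.swap) (simp add: mult.assoc)
  also have "\<dots> = (\<Sum>k<n. (\<Sum>j<n. M i j * ?R j k) * poly (w k) x)"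
    using i by (simp add: R_commute)
  also have "\<dots> = (\<Sum>j<n. M i j * poly (u m j) x)"
    unfolding u_def poly_sum poly_smult sum_distrib_left sum_distrib_right
    by (subst sum.swap) (simp add: mult.assoc)
  finally show ?thesis .
qed

end

subsection \<open>Wronskians\<close>

text \<open>Zeroing the last row makes these cofactors depend on the other rows only, so they can be
  paired with any vector in place of that row.\<close>

definition lastcof :: "(nat \<Rightarrow> nat \<Rightarrow> complex) \<Rightarrow> nat \<Rightarrow> nat \<Rightarrow> complex" where
  "lastcof M N j = cofactor (mat (Suc N) (Suc N) (\<lambda>(i, j). if i = N then 0 else M i j)) N j"

lemma det_last_row:
  "Determinant.det (mat (Suc N) (Suc N) (\<lambda>(i, j). if i = N then v j else M i j))
   = (\<Sum>j<Suc N. v j * lastcof M N j)"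
proof -
  let ?A = "mat (Suc N) (Suc N) (\<lambda>(i, j). if i = N then v j else M i j)"
  have "Determinant.det ?A = (\<Sum>j<Suc N. ?A $$ (N, j) * cofactor ?A N j)"
    by (rule laplace_expansion_row) auto
  also have "\<dots> = (\<Sum>j<Suc N. v j * lastcof M N j)"
  proof (intro sum.cong refl)
    fix j assume "j \<in> {..<Suc N}"
    moreover have "mat_delete ?A N j = mat_delete (mat (Suc N) (Suc N) (\<lambda>(i, j). if i = N then 0 else M i j)) N j"
      by (intro eq_matI) (auto simp: mat_delete_def)
    ultimately show "?A $$ (N, j) * cofactor ?A N j = v j * lastcof M N j"
      by (simp add: lastcof_def cofactor_def)
  qed
  finally show ?thesis .
qed

lemma lastcof_expand:
  "Determinant.det (mat (Suc N) (Suc N) (\<lambda>(i, j). M i j)) = (\<Sum>j<Suc N. M N j * lastcof M N j)"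
proof -
  have "mat (Suc N) (Suc N) (\<lambda>(i, j). M i j) = mat (Suc N) (Suc N) (\<lambda>(i, j). if i = N then M N j else M i j)"
    by (intro eq_matI) auto
  then show ?thesis using det_last_row[of N "M N" M] by simp
qed

lemma lastcof_other:
  assumes "k < N"
  shows "(\<Sum>j<Suc N. M k j * lastcof M N j) = 0"
  unfolding det_last_row[symmetric]
  by (rule det_identical_rows[of _ "Suc N" k N]) (use assms in auto)

lemma lastcof_last: "lastcof M N N = Determinant.det (mat N N (\<lambda>(i, j). M i j))"
proof -
  have "mat_delete (mat (Suc N) (Suc N) (\<lambda>(i, j). if i = N then 0 else M i j)) N N = mat N N (\<lambda>(i, j). M i j)"
    by (intro eq_matI) (auto simp: mat_delete_def)
  then show ?thesis by (simp add: lastcof_def cofactor_def flip: mult_2)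
qed

lemma det_has_field_derivative:
  fixes F F' :: "nat \<Rightarrow> nat \<Rightarrow> complex \<Rightarrow> complex"
  assumes "\<And>i j. i < N \<Longrightarrow> j < N \<Longrightarrow> (F i j has_field_derivative F' i j x) (at x)"
  shows "((\<lambda>x. Determinant.det (mat N N (\<lambda>(i, j). F i j x))) has_field_derivative
    (\<Sum>k<N. Determinant.det (mat N N (\<lambda>(i, j). if i = k then F' i j x else F i j x)))) (at x)"
proof -
  let ?P = "{p. p permutes {0..<N}}"
  have p_lt: "p i < N" if "p \<in> ?P" "i < N" for p i
    using that permutes_in_image[of p "{0..<N}" i] by auto
  have "((\<lambda>x. \<Sum>p\<in>?P. signof p * (\<Prod>i=0..<N. F i (p i) x)) has_field_derivative
     (\<Sum>p\<in>?P. signof p * (\<Sum>k=0..<N. F' k (p k) x * (\<Prod>i\<in>{0..<N} - {k}. F i (p i) x)))) (at x)"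
  proof (intro DERIV_sum DERIV_cmult)
    fix p assume p: "p \<in> ?P"
    have "((\<lambda>x. \<Prod>i=0..<N. F i (p i) x) has_derivative
       (\<lambda>y. \<Sum>k=0..<N. (F' k (p k) x * y) * (\<Prod>i\<in>{0..<N} - {k}. F i (p i) x))) (at x)"
      using assms p_lt[OF p]
      by (intro has_derivative_prod) (auto simp: has_field_derivative_def)
    then show "((\<lambda>x. \<Prod>i=0..<N. F i (p i) x) has_field_derivative
       (\<Sum>k=0..<N. F' k (p k) x * (\<Prod>i\<in>{0..<N} - {k}. F i (p i) x))) (at x)"
    proof -
      assume *: "((\<lambda>x. \<Prod>i=0..<N. F i (p i) x) has_derivative
       (\<lambda>y. \<Sum>k=0..<N. (F' k (p k) x * y) * (\<Prod>i\<in>{0..<N} - {k}. F i (p i) x))) (at x)"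
      have "(\<lambda>y. \<Sum>k=0..<N. (F' k (p k) x * y) * (\<Prod>i\<in>{0..<N} - {k}. F i (p i) x))
        = (*) (\<Sum>k=0..<N. F' k (p k) x * (\<Prod>i\<in>{0..<N} - {k}. F i (p i) x))"
        by (rule ext) (simp add: sum_distrib_left sum_distrib_right mult_ac)
      with * show ?thesis unfolding has_field_derivative_def by simp
    qed
  qed
  moreover have "(\<lambda>x. Determinant.det (mat N N (\<lambda>(i, j). F i j x))) = (\<lambda>x. \<Sum>p\<in>?P. signof p * (\<Prod>i=0..<N. F i (p i) x))"
    using p_lt by (intro ext) (simp add: det_def'[of _ N])
  moreover have "(\<Sum>k<N. Determinant.det (mat N N (\<lambda>(i, j). if i = k then F' i j x else F i j x)))
     = (\<Sum>p\<in>?P. signof p * (\<Sum>k=0..<N. F' k (p k) x * (\<Prod>i\<in>{0..<N} - {k}. F i (p i) x)))"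
  proof -
    have "Determinant.det (mat N N (\<lambda>(i, j). if i = k then F' i j x else F i j x))
       = (\<Sum>p\<in>?P. signof p * (F' k (p k) x * (\<Prod>i\<in>{0..<N} - {k}. F i (p i) x)))" if "k < N" for k
    proof -
      have "(\<Prod>i=0..<N. if i = k then F' i (p i) x else F i (p i) x)
         = F' k (p k) x * (\<Prod>i\<in>{0..<N} - {k}. F i (p i) x)" for p
        using that by (subst prod.remove[of _ k]) (auto intro!: prod.cong)
      then show ?thesis using p_lt by (simp add: det_def'[of _ N])
    qed
    then have "(\<Sum>k<N. Determinant.det (mat N N (\<lambda>(i, j). if i = k then F' i j x else F i j x)))
       = (\<Sum>k<N. \<Sum>p\<in>?P. signof p * (F' k (p k) x * (\<Prod>i\<in>{0..<N} - {k}. F i (p i) x)))"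
      by simp
    also have "\<dots> = (\<Sum>p\<in>?P. \<Sum>k<N. signof p * (F' k (p k) x * (\<Prod>i\<in>{0..<N} - {k}. F i (p i) x)))"
      by (rule sum.swap)
    finally show ?thesis by (simp add: sum_distrib_left atLeast0LessThan)
  qed
  ultimately show ?thesis by simp
qed

lemma wronsk_has_field_derivative:
  assumes "\<And>j. j < Suc N \<Longrightarrow> entire (\<phi> j)"
  shows "(wronsk \<phi> (Suc N) has_field_derivative
    (\<Sum>j<Suc N. (deriv ^^ Suc N) (\<phi> j) x * lastcof (\<lambda>i j. (deriv ^^ i) (\<phi> j) x) N j)) (at x)"
proof -
  let ?D = "\<lambda>k. Determinant.det (mat (Suc N) (Suc N)
     (\<lambda>(i, j). if i = k then (deriv ^^ Suc i) (\<phi> j) x else (deriv ^^ i) (\<phi> j) x))"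
  have "(wronsk \<phi> (Suc N) has_field_derivative (\<Sum>k<Suc N. ?D k)) (at x)"
    unfolding wronsk_def[abs_def]
    by (rule det_has_field_derivative[of "Suc N" "\<lambda>i j. (deriv ^^ i) (\<phi> j)" "\<lambda>i j. (deriv ^^ Suc i) (\<phi> j)" x])
       (intro entire_higher_deriv_has_field_derivative assms)
  also have "(\<Sum>k<Suc N. ?D k) = ?D N"
  proof -
    have "?D k = 0" if "k < N" for k
      by (rule det_identical_rows[of _ "Suc N" k "Suc k"]) (use that in \<open>auto intro!: eq_vecI\<close>)
    then show ?thesis by simp
  qed
  also have "?D N = Determinant.det (mat (Suc N) (Suc N)
     (\<lambda>(i, j). if i = N then (deriv ^^ Suc N) (\<phi> j) x else (deriv ^^ i) (\<phi> j) x))"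
    by (intro arg_cong[of _ _ Determinant.det] eq_matI) auto
  also have "\<dots> = (\<Sum>j<Suc N. (deriv ^^ Suc N) (\<phi> j) x * lastcof (\<lambda>i j. (deriv ^^ i) (\<phi> j) x) N j)"
    by (rule det_last_row)
  finally show ?thesis .
qed

lemma wronsk_Suc:
  "wronsk \<phi> (Suc N) x = (\<Sum>j<Suc N. (deriv ^^ N) (\<phi> j) x * lastcof (\<lambda>i j. (deriv ^^ i) (\<phi> j) x) N j)"
  unfolding wronsk_def by (rule lastcof_expand)

lemma sum_wact_lastcof:
  assumes "degree T \<le> K"
  shows "(\<Sum>j<Suc N. wact T (\<phi> j) x * lastcof (\<lambda>i j. (deriv ^^ i) (\<phi> j) x) N j)
    = (\<Sum>k\<le>K. poly (coeff T k) x * (\<Sum>j<Suc N. (deriv ^^ k) (\<phi> j) x * lastcof (\<lambda>i j. (deriv ^^ i) (\<phi> j) x) N j))"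
proof -
  have "(\<Sum>j<Suc N. wact T (\<phi> j) x * lastcof (\<lambda>i j. (deriv ^^ i) (\<phi> j) x) N j)
    = (\<Sum>j<Suc N. \<Sum>k\<le>K. poly (coeff T k) x * ((deriv ^^ k) (\<phi> j) x * lastcof (\<lambda>i j. (deriv ^^ i) (\<phi> j) x) N j))"
    unfolding wact_bound[OF assms] sum_distrib_right mult.assoc ..
  also have "\<dots> = (\<Sum>k\<le>K. \<Sum>j<Suc N. poly (coeff T k) x * ((deriv ^^ k) (\<phi> j) x * lastcof (\<lambda>i j. (deriv ^^ i) (\<phi> j) x) N j))"
    by (rule sum.swap)
  finally show ?thesis unfolding sum_distrib_left .
qed

text \<open>T phi_j = 0 is paired with the cofactors of the last row: orders below N give repeated
  rows, order N gives W and order N + 1 gives W'. Nothing is divided by the leading coefficient, so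
  its zeros do no harm.\<close>

lemma wronsk_abel:
  assumes "\<And>j. j < Suc N \<Longrightarrow> wact T (\<phi> j) x = 0" "degree T \<le> Suc N"
    and "(wronsk \<phi> (Suc N) has_field_derivative W') (at x)" "\<And>j. j < Suc N \<Longrightarrow> entire (\<phi> j)"
  shows "poly (coeff T (Suc N)) x * W' = - poly (coeff T N) x * wronsk \<phi> (Suc N) x"
proof -
  define L where "L = lastcof (\<lambda>i j. (deriv ^^ i) (\<phi> j) x) N"
  have W': "W' = (\<Sum>j<Suc N. (deriv ^^ Suc N) (\<phi> j) x * L j)"
    unfolding L_def by (rule DERIV_unique[OF assms(3)]) (rule wronsk_has_field_derivative[OF assms(4)])
  have W: "wronsk \<phi> (Suc N) x = (\<Sum>j<Suc N. (deriv ^^ N) (\<phi> j) x * L j)"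
    unfolding L_def by (rule wronsk_Suc)
  have "0 = (\<Sum>k\<le>Suc N. poly (coeff T k) x * (\<Sum>j<Suc N. (deriv ^^ k) (\<phi> j) x * L j))"
    using sum_wact_lastcof[OF assms(2), of \<phi> x N] assms(1) by (simp add: L_def)
  also have "\<dots> = (\<Sum>k<N. poly (coeff T k) x * (\<Sum>j<Suc N. (deriv ^^ k) (\<phi> j) x * L j))
     + poly (coeff T N) x * wronsk \<phi> (Suc N) x + poly (coeff T (Suc N)) x * W'"
    unfolding W W' by (simp only: lessThan_Suc_atMost[symmetric] sum.lessThan_Suc)
  also have "(\<Sum>k<N. poly (coeff T k) x * (\<Sum>j<Suc N. (deriv ^^ k) (\<phi> j) x * L j)) = 0"
    unfolding L_def using lastcof_other[of _ N "\<lambda>i j. (deriv ^^ i) (\<phi> j) x"] by (intro sum.neutral) auto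
  finally have "poly (coeff T (Suc N)) x * W' + poly (coeff T N) x * wronsk \<phi> (Suc N) x = 0"
    by (simp only: add_0 add.commute)
  then show ?thesis by (simp only: add_eq_0_iff2 mult_minus_left)
qed

text \<open>The same pairing with u appended as last column: summed over columns only T u survives,
  summed over orders only order N.\<close>

lemma wact_mult_wronsk:
  assumes "\<And>j. j < N \<Longrightarrow> wact T (\<phi> j) x = 0" "degree T \<le> N"
  shows "wact T u x * wronsk \<phi> N x
    = poly (coeff T N) x * wronsk (\<lambda>p. if p < N then \<phi> p else u) (N + 1) x"
proof -
  define \<psi> where "\<psi> p = (if p < N then \<phi> p else u)" for p
  define L where "L = lastcof (\<lambda>i j. (deriv ^^ i) (\<psi> j) x) N"
  have W: "wronsk \<psi> (Suc N) x = (\<Sum>j<Suc N. (deriv ^^ N) (\<psi> j) x * L j)"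
    unfolding L_def by (rule wronsk_Suc)
  have "L N = Determinant.det (mat N N (\<lambda>(i, j). (deriv ^^ i) (\<psi> j) x))"
    unfolding L_def by (rule lastcof_last)
  also have "mat N N (\<lambda>(i, j). (deriv ^^ i) (\<psi> j) x) = mat N N (\<lambda>(i, j). (deriv ^^ i) (\<phi> j) x)"
    by (intro eq_matI) (auto simp: \<psi>_def)
  finally have LN: "L N = wronsk \<phi> N x" by (simp add: wronsk_def)
  have "(\<Sum>j<Suc N. wact T (\<psi> j) x * L j) = (\<Sum>j<N. wact T (\<phi> j) x * L j) + wact T u x * L N"
    by (simp add: \<psi>_def)
  also have "\<dots> = wact T u x * wronsk \<phi> N x"
    using assms(1) by (simp add: LN)
  finally have "wact T u x * wronsk \<phi> N x = (\<Sum>k\<le>N. poly (coeff T k) x * (\<Sum>j<Suc N. (deriv ^^ k) (\<psi> j) x * L j))"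
    using sum_wact_lastcof[OF assms(2), of \<psi> x N] by (simp add: L_def)
  also have "\<dots> = (\<Sum>k<N. poly (coeff T k) x * (\<Sum>j<Suc N. (deriv ^^ k) (\<psi> j) x * L j))
     + poly (coeff T N) x * wronsk \<psi> (Suc N) x"
    unfolding W by (simp only: lessThan_Suc_atMost[symmetric] sum.lessThan_Suc)
  also have "(\<Sum>k<N. poly (coeff T k) x * (\<Sum>j<Suc N. (deriv ^^ k) (\<psi> j) x * L j)) = 0"
    unfolding L_def using lastcof_other[of _ N "\<lambda>i j. (deriv ^^ i) (\<psi> j) x"] by (intro sum.neutral) auto
  finally show ?thesis by (simp add: \<psi>_def[abs_def])
qed

lemma continuous_eq_0_off_finite:
  fixes h :: "complex \<Rightarrow> complex"
  assumes "continuous_on UNIV h" "finite F" "\<And>x. x \<notin> F \<Longrightarrow> h x = 0"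
  shows "h x = 0"
proof -
  have "open {x. h x \<noteq> 0}"
    using assms(1) by (intro open_Collect_neq continuous_intros)
  moreover have "finite {x. h x \<noteq> 0}"
    by (rule finite_subset[OF _ assms(2)]) (use assms(3) in blast)
  ultimately have "{x. h x \<noteq> 0} = {}"
    using finite_imp_not_open by blast
  then show ?thesis by blast
qed

text \<open>W/p has derivative 0 off the finitely many roots of p, a connected set; continuity
  carries W = c p across the roots.\<close>

lemma log_derivative_eq_poly:
  fixes W :: "complex \<Rightarrow> complex" and p :: "complex poly"
  assumes W: "\<And>x. (W has_field_derivative W' x) (at x)"
    and eq: "\<And>x. poly p x * W' x = poly (pderiv p) x * W x" and "p \<noteq> 0"
  obtains c where "\<And>x. W x = c * poly p x"
proof -
  let ?F = "{x. poly p x = 0}"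
  have F: "finite ?F" using \<open>p \<noteq> 0\<close> by (rule poly_roots_finite)
  have S: "connected (UNIV - ?F)" by (rule connected_open_delete_finite) (use F in auto)
  have o: "open (UNIV - ?F)" using F by (simp add: open_Diff finite_imp_closed)
  have d: "((\<lambda>x. W x / poly p x) has_field_derivative 0) (at x)" if "poly p x \<noteq> 0" for x
  proof -
    have "((\<lambda>x. W x / poly p x) has_field_derivative (W' x * poly p x - W x * poly (pderiv p) x) / (poly p x * poly p x)) (at x)"
      by (intro DERIV_divide W poly_DERIV that)
    then show ?thesis using eq[of x] by (simp add: mult.commute)
  qed
  have "continuous_on (UNIV - ?F) (\<lambda>x. W x / poly p x)"
    using d by (intro continuous_at_imp_continuous_on) (auto intro: DERIV_isCont)
  from DERIV_zero_connected_constant[OF S o finite.emptyI this]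
  obtain c where c: "\<And>x. x \<in> UNIV - ?F \<Longrightarrow> W x / poly p x = c"
    using d by auto
  have "continuous_on UNIV (\<lambda>x. W x - c * poly p x)"
    using W by (intro continuous_at_imp_continuous_on ballI continuous_intros) (auto intro: DERIV_isCont)
  from continuous_eq_0_off_finite[OF this F]
  have "W x - c * poly p x = 0" for x
    using c by (fastforce simp: field_simps)
  then show ?thesis by (intro that[of c]) (simp add: eq_iff_diff_eq_0[symmetric])
qed

subsection \<open>The bispectral pair of operators\<close>

lemma dapp_point: "dapp (\<lambda>\<nu>. if \<nu> = \<mu> then [:c, 1:] else 0) h = c * h \<mu> + deriv h \<mu>"
  by (subst dapp_superset[of "{\<mu>}"]) (auto simp: pact_linear)

lemma cbasis_in_Sdist: "cbasis lam gam i \<in> Sdist"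
  by (auto simp: Sdist_def cbasis_def intro: finite_subset[of _ "{lam i}"])

lemma wact_dspan:
  assumes "entire g" "D \<in> dspan n lam gam"
    and "\<And>i. i < n \<Longrightarrow> wact T (dhat (cbasis lam gam i) g) x = 0"
  shows "wact T (dhat D g) x = 0"
proof -
  obtain t where D: "D = (\<lambda>\<mu>. \<Sum>i<n. Polynomial.smult (t i) (cbasis lam gam i \<mu>))"
    using assms(2) by (auto simp: dspan_def)
  have "dhat D g = (\<lambda>y. \<Sum>i<n. t i * dhat (cbasis lam gam i) g y)"
    unfolding D dhat_def by (simp add: dapp_lincomb cbasis_in_Sdist)
  then have "wact T (dhat D g) x = (\<Sum>i<n. t i * wact T (dhat (cbasis lam gam i) g) x)"
    by (simp add: wact_lincomb entire_dhat assms(1))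
  then show ?thesis using assms(3) by simp
qed

context airy
begin

lemma dapp_point_dstep:
  assumes g: "g \<in> kerL0 r a"
  shows "dapp (\<lambda>\<nu>. if \<nu> = \<mu> then [:c, 1:] else 0) (\<lambda>z. \<Sum>m<r. poly (S m) z * (deriv ^^ m) g (x + z))
    = (\<Sum>m<r. (c * poly (S m) \<mu> + poly (dstep x S m) \<mu>) * (deriv ^^ m) g (x + \<mu>))"
  unfolding dapp_point DERIV_imp_deriv[OF dstep_has_field_derivative[OF g]]
  by (simp add: sum.distrib sum_distrib_left algebra_simps)

end

context airy_nodes
begin

text \<open>The formula of the overview as an operator: polynomials in z become polynomials in L_0.
  \<open>Tz\<close> arises by exchanging tau with q and u with \<open>qi\<close>, that is, x with z
  (\<open>Hx_Hz\<close>).\<close>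

definition Tx :: weyl where
  "Tx = Polynomial.smult tau_X (pL0 r a q)
     - (\<Sum>m<r. \<Sum>i<n. Polynomial.smult (u m i) (wmult (monom 1 m) (pL0 r a (qi i))))"

definition Tz :: weyl where
  "Tz = Polynomial.smult q (pL0 r a tau_X)
     - (\<Sum>m<r. \<Sum>i<n. Polynomial.smult (qi i) (wmult (monom 1 m) (pL0 r a (u m i))))"

definition Hx :: "nat \<Rightarrow> complex \<Rightarrow> complex poly" where
  "Hx m x = (if m = 0 then Polynomial.smult (poly tau_X x) q else 0) - (\<Sum>i<n. Polynomial.smult (poly (u m i) x) (qi i))"

definition Hz :: "nat \<Rightarrow> complex \<Rightarrow> complex poly" where
  "Hz m x = (if m = 0 then Polynomial.smult (poly q x) tau_X else 0) - (\<Sum>i<n. Polynomial.smult (poly (qi i) x) (u m i))"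

lemma sum_H:
  fixes c :: complex and e h :: "nat \<Rightarrow> complex"
  shows "c * h 0 - (\<Sum>m<r. e m * h m) = (\<Sum>m<r. ((if m = 0 then c else 0) - e m) * h m)"
  using r sum_delta_left(2)[of 0 r "\<lambda>_. c" h] by (simp add: left_diff_distrib sum_subtractf)

lemma wact_Tx:
  assumes g: "g \<in> kerL0 r a"
  shows "wact Tx (\<lambda>x. g (x + z)) x = (\<Sum>m<r. poly (Hx m x) z * (deriv ^^ m) g (x + z))"
proof -
  have "wact Tx (\<lambda>x. g (x + z)) x = poly tau_X x * poly q z * (deriv ^^ 0) g (x + z)
     - (\<Sum>m<r. (\<Sum>i<n. poly (u m i) x * poly (qi i) z) * (deriv ^^ m) g (x + z))"
    by (simp add: Tx_def wact_diff wact_sum wact_smult wact_pL0_shift[OF g] wact_monom_pL0_shift[OF g]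
        sum_distrib_right mult.assoc)
  also have "\<dots> = (\<Sum>m<r. ((if m = 0 then poly tau_X x * poly q z else 0) - (\<Sum>i<n. poly (u m i) x * poly (qi i) z)) * (deriv ^^ m) g (x + z))"
    by (rule sum_H)
  also have "\<dots> = (\<Sum>m<r. poly (Hx m x) z * (deriv ^^ m) g (x + z))"
    by (intro sum.cong refl) (simp add: Hx_def poly_sum)
  finally show ?thesis .
qed

lemma wact_Tz:
  assumes g: "g \<in> kerL0 r a"
  shows "wact Tz (\<lambda>x. g (x + z)) x = (\<Sum>m<r. poly (Hz m x) z * (deriv ^^ m) g (x + z))"
proof -
  have "wact Tz (\<lambda>x. g (x + z)) x = poly q x * poly tau_X z * (deriv ^^ 0) g (x + z)
     - (\<Sum>m<r. (\<Sum>i<n. poly (qi i) x * poly (u m i) z) * (deriv ^^ m) g (x + z))"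
    by (simp add: Tz_def wact_diff wact_sum wact_smult wact_pL0_shift[OF g] wact_monom_pL0_shift[OF g]
        sum_distrib_right mult.assoc)
  also have "\<dots> = (\<Sum>m<r. ((if m = 0 then poly q x * poly tau_X z else 0) - (\<Sum>i<n. poly (qi i) x * poly (u m i) z)) * (deriv ^^ m) g (x + z))"
    by (rule sum_H)
  also have "\<dots> = (\<Sum>m<r. poly (Hz m x) z * (deriv ^^ m) g (x + z))"
    by (intro sum.cong refl) (simp add: Hz_def poly_sum)
  finally show ?thesis .
qed

lemma Hx_Hz: "poly (Hx m x) z = poly (Hz m z) x"
  by (simp add: Hx_def Hz_def poly_sum mult.commute)

lemma Tx_Tz:
  assumes g: "g \<in> kerL0 r a"
  shows "wact Tx (\<lambda>x. g (x + z)) x = wact Tz (\<lambda>z. g (x + z)) z"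
  using wact_Tx[OF g, of z x] wact_Tz[OF g, of x z] by (simp add: Hx_Hz add.commute)

lemma wflat_Tx: "wflat r a Tx = Tz"
proof (rule weyl_eqI)
  fix j x z assume "j < r"
  then show "wact (wflat r a Tx) (\<lambda>x. f j (x + z)) x = wact Tz (\<lambda>x. f j (x + z)) x"
    using Tx_Tz[OF f_ker, of j x z] by (simp add: wact_wflat_shift f_ker add.commute)
qed

lemma wflat_Tz: "wflat r a Tz = Tx"
proof (rule weyl_eqI)
  fix j x z assume "j < r"
  then show "wact (wflat r a Tz) (\<lambda>x. f j (x + z)) x = wact Tx (\<lambda>x. f j (x + z)) x"
    using Tx_Tz[OF f_ker, of j z x] by (simp add: wact_wflat_shift f_ker add.commute)
qed

text \<open>In \<open>Hx\<close> and \<open>Hz\<close> degree n occurs only at m = 0 and all other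
  terms have degree at most n - 1, so no weight exceeds r n.\<close>

lemma weight_ge:
  assumes "m < r" "r * n < r * e + m"
  shows "e \<ge> n" "m = 0 \<Longrightarrow> e > n"
proof -
  have "r * n < r * Suc e" using assms by simp
  then show "e \<ge> n" by (metis mult_less_cancel1 less_Suc_eq_le)
  show "e > n" if "m = 0" using assms that by simp
qed

lemma coeff_qi_0: "i < n \<Longrightarrow> e \<ge> n \<Longrightarrow> coeff (qi i) e = 0"
  using n by (intro coeff_eq_0) (simp add: degree_qi)

lemma coeff_u_0: "e \<ge> n \<Longrightarrow> coeff (u m i) e = 0"
  using n degree_u[of m i] by (intro coeff_eq_0) simp

lemma degree_Tx: "degree Tx \<le> r * n"
proof (rule degree_weyl_le[OF wact_Tx])
  fix m x e assume "m < r" "r * n < r * e + m"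
  then show "coeff (Hx m x) e = 0"
    using weight_ge[of m e] degree_q by (auto simp: Hx_def coeff_sum coeff_qi_0 coeff_eq_0)
qed (use f_ker in auto)

lemma degree_Tz: "degree Tz \<le> r * n"
proof (rule degree_weyl_le[OF wact_Tz])
  fix m x e assume "m < r" "r * n < r * e + m"
  then show "coeff (Hz m x) e = 0"
    using weight_ge[of m e] degree_tau_X by (auto simp: Hz_def coeff_sum coeff_u_0 coeff_eq_0)
qed (use f_ker in auto)

text \<open>In weight r n - 1 the normal form has minus the sum of the \<open>w i\<close>, which is
  -tau' by \<open>sum_w\<close>. For \<open>Tz\<close> the \<open>w i\<close> enter through their
  top coefficients 1, leaving minus the sum of the \<open>qi i\<close>, which is -q'.\<close>

lemma coeff_Tx: "coeff Tx (r * n) = tau_X"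
  and coeff_Tx': "coeff Tx (r * n - 1) = - pderiv tau_X"
proof -
  have "poly (coeff Tx (r * n)) x = poly tau_X x" for x
    using coeff_weyl_top[OF wact_Tx degree_Tx, of x] f_ker monic_q degree_q
    by (simp add: Hx_def coeff_sum coeff_qi_0)
  then show "coeff Tx (r * n) = tau_X" by (simp add: poly_eq_poly_eq_iff[symmetric] fun_eq_iff)
  have "poly (coeff Tx (r * n - 1)) x = - (\<Sum>i<n. poly (u (r - 1) i) x * coeff (qi i) (n - 1))" for x
    using coeff_weyl_subtop[OF wact_Tx degree_Tx n, of x] f_ker r
    by (simp add: Hx_def coeff_sum)
  then have "poly (coeff Tx (r * n - 1)) x = - poly (pderiv tau_X) x" for x
    by (simp only: u_last sum_w[symmetric] poly_sum) (simp add: coeff_qi_top[unfolded One_nat_def] u_last[unfolded One_nat_def])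
  then show "coeff Tx (r * n - 1) = - pderiv tau_X" by (simp add: poly_eq_poly_eq_iff[symmetric] fun_eq_iff)
qed

lemma coeff_Tz: "coeff Tz (r * n) = q"
  and coeff_Tz': "coeff Tz (r * n - 1) = - pderiv q"
proof -
  have "poly (coeff Tz (r * n)) x = poly q x" for x
    using coeff_weyl_top[OF wact_Tz degree_Tz, of x] f_ker monic_tau_X degree_tau_X
    by (simp add: Hz_def coeff_sum coeff_u_0)
  then show "coeff Tz (r * n) = q" by (simp add: poly_eq_poly_eq_iff[symmetric] fun_eq_iff)
  have uw: "u (r - 1) i = w i" if "i < n" for i
    using u_last[OF that] by (simp add: poly_eq_poly_eq_iff[symmetric] fun_eq_iff)
  have "poly (coeff Tz (r * n - 1)) x = - poly (pderiv q) x" for x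
  proof -
    have "poly (coeff Tz (r * n - 1)) x = - (\<Sum>i<n. poly (qi i) x * coeff (u (r - 1) i) (n - 1))"
      using coeff_weyl_subtop[OF wact_Tz degree_Tz n, of x] f_ker r
      by (simp add: Hz_def coeff_sum)
    also have "(\<Sum>i<n. poly (qi i) x * coeff (u (r - 1) i) (n - 1)) = (\<Sum>i<n. poly (qi i) x)"
      by (intro sum.cong refl) (simp only: uw coeff_w_top lessThan_iff mult_1_right)
    finally show ?thesis by (simp add: pderiv_q poly_sum)
  qed
  then show "coeff Tz (r * n - 1) = - pderiv q" by (simp add: poly_eq_poly_eq_iff[symmetric] fun_eq_iff)
qed

lemma sum_pderiv_qi:
  assumes "i < n"
  shows "(\<Sum>j<n. V j * poly (pderiv (qi j)) (lam i)) = poly (qi i) (lam i) * ((\<Sum>j<n. M i j * V j) - gam i * V i)"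
proof -
  have "poly (qi i) (lam i) * (M i j * V j) = V j * poly (pderiv (qi j)) (lam i) + (if i = j then poly (qi i) (lam i) * gam i else 0) * V j" for j
    using poly_qi_self[OF assms] by (simp add: M_def field_simps)
  then have "poly (qi i) (lam i) * (\<Sum>j<n. M i j * V j) = (\<Sum>j<n. V j * poly (pderiv (qi j)) (lam i)) + poly (qi i) (lam i) * gam i * V i"
    using assms by (simp add: sum_distrib_left sum.distrib sum_delta_left)
  then show ?thesis by (simp add: algebra_simps)
qed

lemma sum_qi_lam: "i < n \<Longrightarrow> (\<Sum>j<n. V j * poly (qi j) (lam i)) = V i * poly (qi i) (lam i)"
  by (subst sum.remove[of _ i]) (auto simp: poly_qi_other intro!: sum.neutral)

text \<open>At z = \<open>lam i\<close> only \<open>qi i\<close> survives in \<open>Hx\<close>,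
  while z-derivatives of the \<open>qi j\<close> bring in M. The terms with \<open>gam i\<close>
  cancel, and order by order \<open>u_0\<close> and \<open>u_pred\<close> remain.\<close>

lemma Tx_annihilates:
  assumes g: "g \<in> kerL0 r a" and i: "i < n"
  shows "wact Tx (dhat (cbasis lam gam i) g) x = 0"
proof -
  let ?Q = "poly (qi i) (lam i)"
  have S: "poly (Hx m x) (lam i) = - poly (u m i) x * ?Q" for m
    using sum_qi_lam[OF i, of "\<lambda>j. poly (u m j) x"] i by (simp add: Hx_def poly_sum poly_q_lam)
  have dS: "poly (pderiv (Hx m x)) (lam i) = (if m = 0 then poly tau_X x * ?Q else 0)
      - ?Q * ((\<Sum>j<n. M i j * poly (u m j) x) - gam i * poly (u m i) x)" for m
    using sum_pderiv_qi[OF i, of "\<lambda>j. poly (u m j) x"] i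
    by (simp add: Hx_def poly_sum pderiv_diff pderiv_sum pderiv_smult pderiv_q_lam)
  have "gam i * poly (Hx m x) (lam i) + poly (dstep x (\<lambda>m. Hx m x) m) (lam i) = 0" if "m < r" for m
  proof (cases "m = 0")
    case True
    then show ?thesis
      using u_0[OF i, of x, symmetric] u_last[OF i, of x]
      by (simp add: dstep_def dS S) (simp add: algebra_simps)
  next
    case False
    then show ?thesis
      using u_pred[OF i that False, of x] u_last[OF i, of x]
      by (simp add: dstep_def dS S) (simp add: algebra_simps)
  qed
  then show ?thesis
    by (simp add: wact_dhat kerL0_entire[OF g] wact_Tx[OF g] cbasis_def[abs_def] dapp_point_dstep[OF g])
qed

text \<open>By \<open>pderiv_u_root\<close>, d_z + \<open>gam_dual\<close> acts on the vectors u m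
  at the root as M. Orders m > 0 then vanish by \<open>u_pred\<close>; for m = 0, \<open>u_0\<close>
  turns each \<open>qi i\<close> into q, and the entries of w sum to tau'.\<close>

lemma Tz_annihilates:
  assumes g: "g \<in> kerL0 r a" and root: "poly tau_X \<mu> = 0" "poly (pderiv tau_X) \<mu> \<noteq> 0"
  shows "wact Tz (dhat (\<lambda>\<nu>. if \<nu> = \<mu> then [:gam_dual \<mu>, 1:] else 0) g) x = 0"
proof -
  let ?c = "gam_dual \<mu>"
  have S: "poly (Hz m x) \<mu> = - (\<Sum>i<n. poly (qi i) x * poly (u m i) \<mu>)" for m
    using root by (simp add: Hz_def poly_sum)
  have dS: "poly (pderiv (Hz m x)) \<mu> = (if m = 0 then poly q x * poly (pderiv tau_X) \<mu> else 0)
      - (\<Sum>i<n. poly (qi i) x * ((\<Sum>k<n. M i k * poly (u m k) \<mu>) - ?c * poly (u m i) \<mu>))" for m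
    using pderiv_u_root[OF root] by (simp add: Hz_def poly_sum pderiv_diff pderiv_sum pderiv_smult)
  have last: "poly (Hz (r - 1) x) \<mu> = - (\<Sum>i<n. poly (qi i) x * poly (w i) \<mu>)"
    unfolding S by (intro arg_cong[of _ _ uminus] sum.cong refl) (simp only: u_last lessThan_iff)
  have "?c * poly (Hz m x) \<mu> + poly (dstep x (\<lambda>m. Hz m x) m) \<mu> = 0" if "m < r" for m
  proof (cases "m = 0")
    case True
    have "?c * poly (Hz m x) \<mu> + poly (dstep x (\<lambda>m. Hz m x) m) \<mu>
      = poly q x * poly (pderiv tau_X) \<mu> - (\<Sum>i<n. poly (qi i) x * ((\<Sum>k<n. M i k * poly (u 0 k) \<mu>) + (x + \<mu>) * poly (w i) \<mu>))"
      unfolding dstep_def using True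
      by (simp add: dS last[unfolded One_nat_def] S[of 0]) (simp add: algebra_simps sum.distrib sum_subtractf sum_distrib_left)
    also have "(\<Sum>i<n. poly (qi i) x * ((\<Sum>k<n. M i k * poly (u 0 k) \<mu>) + (x + \<mu>) * poly (w i) \<mu>))
      = (\<Sum>i<n. poly q x * poly (w i) \<mu>)"
    proof (intro sum.cong refl)
      fix i assume "i \<in> {..<n}"
      then have i: "i < n" by simp
      have "(\<Sum>k<n. M i k * poly (u 0 k) \<mu>) = - ((\<mu> + lam i) * poly (w i) \<mu>)"
        using u_0[OF i, of \<mu>] root by (simp add: eq_neg_iff_add_eq_0)
      then have "(\<Sum>k<n. M i k * poly (u 0 k) \<mu>) + (x + \<mu>) * poly (w i) \<mu> = (x - lam i) * poly (w i) \<mu>"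
        by (simp only:) (simp add: algebra_simps)
      moreover have "poly q x = (x - lam i) * poly (qi i) x"
        unfolding q_eq[OF i] by (simp add: algebra_simps)
      ultimately show "poly (qi i) x * ((\<Sum>k<n. M i k * poly (u 0 k) \<mu>) + (x + \<mu>) * poly (w i) \<mu>) = poly q x * poly (w i) \<mu>"
        by (simp only: mult_ac)
    qed
    also have "\<dots> = poly q x * poly (pderiv tau_X) \<mu>"
      by (simp add: sum_w[symmetric] poly_sum sum_distrib_left)
    finally show ?thesis by simp
  next
    case False
    have "?c * poly (Hz m x) \<mu> + poly (dstep x (\<lambda>m. Hz m x) m) \<mu>
      = - (\<Sum>i<n. poly (qi i) x * ((\<Sum>k<n. M i k * poly (u m k) \<mu>) + poly (u (m - 1) i) \<mu> + ac m * poly (w i) \<mu>))"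
      unfolding dstep_def using False
      by (simp add: dS last[unfolded One_nat_def] S[of m] S[of "m - Suc 0"]) (simp add: algebra_simps sum.distrib sum_subtractf sum_distrib_left)
    also have "\<dots> = 0"
      using u_pred[OF _ that False, of _ \<mu>] by simp
    finally show ?thesis .
  qed
  then show ?thesis
    by (simp add: wact_dhat kerL0_entire[OF g] wact_Tz[OF g] dapp_point_dstep[OF g])
qed

end

subsection \<open>The Wronskian of the functions annihilated\<close>

context airy_nodes
begin

lemma lagrange_interpolation:
  assumes "degree S \<le> n - 1"
  shows "S = (\<Sum>j<n. Polynomial.smult (poly S (lam j) / poly (qi j) (lam j)) (qi j))"
proof -
  define D where "D = S - (\<Sum>j<n. Polynomial.smult (poly S (lam j) / poly (qi j) (lam j)) (qi j))"
  have "poly D (lam i) = 0" if "i < n" for i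
    using sum_qi_lam[OF that, of "\<lambda>j. poly S (lam j) / poly (qi j) (lam j)"] poly_qi_self[OF that]
    by (simp add: D_def poly_sum)
  then have sub: "lam ` {..<n} \<subseteq> {x. poly D x = 0}" by auto
  have "D = 0"
  proof (rule ccontr)
    assume "D \<noteq> 0"
    have "n = card (lam ` {..<n})" using inj by (simp add: card_image)
    also have "\<dots> \<le> card {x. poly D x = 0}"
      using sub \<open>D \<noteq> 0\<close> by (intro card_mono poly_roots_finite)
    also have "\<dots> \<le> degree D" by (rule card_poly_roots_bound[OF \<open>D \<noteq> 0\<close>])
    also have "\<dots> \<le> n - 1"
      unfolding D_def using assms degree_qi
      by (intro degree_diff_le degree_sum_le) (auto intro: order.trans[OF degree_smult_le])
    finally show False using n by simp
  qed
  then show ?thesis by (simp add: D_def)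
qed

text \<open>A linear relation between the rows of the Wronskian matrix at \<open>x\<close> is an operator with
  constant coefficients; its normal form solves the equations characterizing \<open>u\<close>, with
  right-hand side 0 instead of \<open>tau_X\<close>.\<close>

lemma wronsk_phis_nonzero:
  assumes x: "poly tau_X x \<noteq> 0"
  shows "wronsk (phis r f lam gam) (r * n) x \<noteq> 0"
proof
  assume "wronsk (phis r f lam gam) (r * n) x = 0"
  then obtain v where v: "\<exists>k<r*n. v k \<noteq> 0"
    and v0: "\<And>p. p < r * n \<Longrightarrow> (\<Sum>k<r*n. v k * (deriv ^^ k) (phis r f lam gam p) x) = 0"
    unfolding wronsk_def det_eq_0_iff_row_null by blast
  define d where "d = r * n - 1"
  have rn: "r * n = Suc d" using r n by (simp add: d_def)
  have lt: "{..<r * n} = {..d}" unfolding rn by (rule lessThan_Suc_atMost)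
  define S where "S m = pcompose (NFsum v d m) [:x, 1:]" for m
  have eq: "gam i * poly (S m) (lam i) + poly (dstep x S m) (lam i) = 0" if i: "i < n" and m: "m < r" for i m
  proof (rule wronskian_vanish[of "\<lambda>m. gam i * poly (S m) (lam i) + poly (dstep x S m) (lam i)" "x + lam i", OF _ m])
    fix j assume j: "j < r"
    have "i * r + j < r * n"
    proof -
      have "i * r + j < Suc i * r" using j by simp
      also have "\<dots> \<le> n * r" using i by (intro mult_le_mono1) simp
      finally show ?thesis by (simp add: mult.commute)
    qed
    from v0[OF this] have "0 = (\<Sum>k\<le>d. v k * (deriv ^^ k) (dhat (cbasis lam gam i) (f j)) x)"
      using j r by (simp add: lt phis_def)
    also have "\<dots> = (\<Sum>k\<le>d. v k * dapp (cbasis lam gam i) (\<lambda>z. (deriv ^^ k) (f j) (x + z)))"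
      by (simp add: higher_deriv_dhat f_entire[OF j]) (simp add: dhat_def)
    also have "\<dots> = dapp (cbasis lam gam i) (\<lambda>z. \<Sum>k\<le>d. v k * (deriv ^^ k) (f j) (x + z))"
      by (intro dapp_lincomb_fun[symmetric] entire_shift' entire_higher_deriv f_entire j)
    also have "\<dots> = dapp (cbasis lam gam i) (\<lambda>z. \<Sum>m<r. poly (S m) z * (deriv ^^ m) (f j) (x + z))"
      by (simp add: sum_higher_deriv_NFsum[OF f_ker[OF j]] S_def poly_pcompose)
    also have "\<dots> = (\<Sum>m<r. (gam i * poly (S m) (lam i) + poly (dstep x S m) (lam i)) * (deriv ^^ m) (f j) (x + lam i))"
      by (simp add: cbasis_def[abs_def] dapp_point_dstep[OF f_ker[OF j]])
    finally show "(\<Sum>m<r. (gam i * poly (S m) (lam i) + poly (dstep x S m) (lam i)) * (deriv ^^ m) (f j) (x + lam i)) = 0"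
      by simp
  qed
  \<comment> \<open>Row indices, and hence weights, stay below r n. So each S m is recovered from
    its values at the n nodes.\<close>
  have degS: "degree (S m) \<le> n - 1" if "m < r" for m
  proof -
    have "degree (NFsum v d m) \<le> n - 1"
      using n rn by (intro degree_NFsum that) simp
    then show ?thesis by (simp add: S_def degree_pcompose)
  qed
  define V where "V m j = poly (S m) (lam j) / poly (qi j) (lam j)" for m j
  have S_lagrange: "S m = (\<Sum>j<n. Polynomial.smult (V m j) (qi j))" if "m < r" for m
    unfolding V_def by (rule lagrange_interpolation[OF degS[OF that]])
  have S_lam: "poly (S m) (lam i) = poly (qi i) (lam i) * V m i" if "i < n" for m i
    using poly_qi_self[OF that] by (simp add: V_def)
  have dS_lam: "poly (pderiv (S m)) (lam i) = poly (qi i) (lam i) * ((\<Sum>j<n. M i j * V m j) - gam i * V m i)"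
    if "i < n" "m < r" for m i
    by (subst S_lagrange[OF that(2)]) (simp add: pderiv_sum pderiv_smult poly_sum sum_pderiv_qi[OF that(1)])
  have V_0: "(\<Sum>j<n. M i j * V 0 j) + (x + lam i) * V (r - 1) i = 0" if i: "i < n" for i
  proof -
    have "poly (qi i) (lam i) * ((\<Sum>j<n. M i j * V 0 j) + (x + lam i) * V (r - 1) i) = 0"
      using eq[OF i, of 0] r by (simp add: dstep_def dS_lam[OF i] S_lam[OF i] algebra_simps)
    then show ?thesis using poly_qi_self[OF i] by simp
  qed
  have V_pred: "V (m - 1) i = - (\<Sum>j<n. M i j * V m j) - ac m * V (r - 1) i" if i: "i < n" and "m < r" "m \<noteq> 0" for i m
  proof -
    have "poly (qi i) (lam i) * ((\<Sum>j<n. M i j * V m j) + V (m - 1) i + ac m * V (r - 1) i) = 0"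
      using eq[OF i \<open>m < r\<close>] that by (simp add: dstep_def dS_lam[OF i] S_lam[OF i] algebra_simps)
    then have "(\<Sum>j<n. M i j * V m j) + V (m - 1) i + ac m * V (r - 1) i = 0"
      using poly_qi_self[OF i] by simp
    then show ?thesis by (simp add: algebra_simps eq_neg_iff_add_eq_0)
  qed
  have V_R: "V (r - 1 - s) i = (\<Sum>j<n. R s i j * V (r - 1) j)" if "s < r" "i < n" for s i
    using that
  proof (induction s arbitrary: i)
    case 0
    then show ?case by (simp add: sum_delta_left)
  next
    case (Suc s)
    have "V (r - 1 - Suc s) i = V (r - 1 - s - 1) i" by simp
    also have "\<dots> = - (\<Sum>j<n. M i j * V (r - 1 - s) j) - ac (r - 1 - s) * V (r - 1) i"
      using Suc.prems by (intro V_pred) auto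
    also have "\<dots> = (\<Sum>j<n. R (Suc s) i j * V (r - 1) j)"
      using Suc by (subst R_Suc_apply) auto
    finally show ?case .
  qed
  \<comment> \<open>The equation of order 0 closes the recursion to (x - X) V = 0 for V = V (r - 1),
    and x - X is invertible off the roots of tau.\<close>
  have "V (r - 1) i = 0" if "i < n" for i
  proof (rule Y_nonsingular[OF x _ that])
    fix i assume i: "i < n"
    have "(\<Sum>j<n. R r i j * V (r - 1) j) = - (\<Sum>j<n. M i j * V 0 j)"
      using R_Suc_apply[OF i, of "r - 1" "V (r - 1)"] V_R[of "r - 1"] r by simp
    also have "\<dots> = (x + lam i) * V (r - 1) i"
      using V_0[OF i] by (simp add: minus_unique)
    finally have "(\<Sum>j<n. R r i j * V (r - 1) j) = (x + lam i) * V (r - 1) i" .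
    moreover have "(\<Sum>j<n. Y x i j * V (r - 1) j) = (\<Sum>j<n. (if i = j then x + lam i else 0) * V (r - 1) j) - (\<Sum>j<n. R r i j * V (r - 1) j)"
      unfolding sum_subtractf[symmetric] by (intro sum.cong refl) (auto simp: Y_def X_def algebra_simps)
    ultimately show "(\<Sum>j<n. Y x i j * V (r - 1) j) = 0"
      using i by (simp add: sum_delta_left)
  qed
  then have "V m i = 0" if "m < r" "i < n" for m i
    using V_R[of "r - 1 - m" i] that by simp
  then have "S m = 0" if "m < r" for m
    using S_lagrange[OF that] that by simp
  then have "NFsum v d m = 0" if "m < r" for m
    using that by (simp add: S_def pcompose_eq_0_iff)
  then have "v k = 0" if "k < r * n" for k
    using that NFsum_eq_0_imp[of v d k] rn by simp
  then show False using v by blast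
qed

lemma phis_entire: "p < r * n \<Longrightarrow> entire (phis r f lam gam p)"
  using r by (simp add: phis_def entire_dhat f_entire)

text \<open>Abel's identity yields W = c t for the Wronskian W of the phi's. Then
  \<open>wact_mult_wronsk\<close> reads c t T u = t W(phi, u), and t is cancelled, at its roots by
  continuity.\<close>

lemma wact_eq_wronsk:
  assumes deg: "degree T \<le> r * n" and top: "coeff T (r * n) = t" "coeff T (r * n - 1) = - pderiv t"
    and kill: "\<And>p x. p < r * n \<Longrightarrow> wact T (phis r f lam gam p) x = 0" and "t \<noteq> 0"
  shows "\<exists>\<kappa>. \<kappa> \<noteq> 0 \<and> (\<forall>u. entire u \<longrightarrow> (\<forall>x. wact T u x
     = \<kappa> * wronsk (\<lambda>p. if p < r * n then phis r f lam gam p else u) (r * n + 1) x))"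
proof -
  let ?W = "wronsk (phis r f lam gam) (r * n)"
  obtain N where N: "r * n = Suc N" using r n by (cases "r * n") auto
  have e: "entire (phis r f lam gam p)" if "p < Suc N" for p
    using phis_entire that N by simp
  have d: "(wronsk \<phi> (Suc K) has_field_derivative deriv (wronsk \<phi> (Suc K)) x) (at x)"
    if "\<And>p. p < Suc K \<Longrightarrow> entire (\<phi> p)" for \<phi> K x
    using wronsk_has_field_derivative[of K \<phi> x] that by (auto simp: DERIV_imp_deriv)
  have "poly t x * deriv ?W x = poly (pderiv t) x * ?W x" for x
    using wronsk_abel[of N T "phis r f lam gam" x, OF _ _ d] e kill deg top by (simp add: N)
  moreover have "(?W has_field_derivative deriv ?W x) (at x)" for x
    using d[of N "phis r f lam gam" x] e by (simp add: N)
  ultimately obtain c where c: "\<And>x. ?W x = c * poly t x"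
    using log_derivative_eq_poly[of ?W "deriv ?W" t] \<open>t \<noteq> 0\<close> by metis
  \<comment> \<open>Here t is not known to be \<open>tau_X\<close>; one point off the roots of
    \<open>tau_X\<close> suffices to exclude c = 0.\<close>
  have "tau_X \<noteq> 0" using monic_tau_X by force
  then obtain x0 where "poly tau_X x0 \<noteq> 0" using poly_all_0_iff_0 by blast
  from wronsk_phis_nonzero[OF this] have "c \<noteq> 0" using c[of x0] by auto
  have "wact T u x = (1 / c) * wronsk (\<lambda>p. if p < r * n then phis r f lam gam p else u) (r * n + 1) x"
    if u: "entire u" for u x
  proof -
    let ?Wu = "wronsk (\<lambda>p. if p < r * n then phis r f lam gam p else u) (r * n + 1)"
    have "continuous_on UNIV (wact T u)"
      using u by (intro holomorphic_on_imp_continuous_on entire_wact)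
    moreover have "continuous_on UNIV ?Wu"
    proof -
      have "entire (if p < r * n then phis r f lam gam p else u)" for p
        using u phis_entire by simp
      then have "(?Wu has_field_derivative deriv ?Wu x) (at x)" for x
        using d[of "r * n" "\<lambda>p. if p < r * n then phis r f lam gam p else u" x] by simp
      then show ?thesis
        by (intro continuous_at_imp_continuous_on ballI) (rule DERIV_isCont)
    qed
    ultimately have "continuous_on UNIV (\<lambda>x. c * wact T u x - ?Wu x)"
      by (intro continuous_intros)
    moreover have "c * wact T u x - ?Wu x = 0" if "x \<notin> {x. poly t x = 0}" for x
    proof -
      have "wact T u x * (c * poly t x) = poly t x * ?Wu x"
        using wact_mult_wronsk[of "r * n" T "phis r f lam gam" x u] kill deg by (simp add: c top)
      then show ?thesis using that by (simp add: algebra_simps)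
    qed
    ultimately have "c * wact T u x - ?Wu x = 0"
      by (rule continuous_eq_0_off_finite[OF _ poly_roots_finite[OF \<open>t \<noteq> 0\<close>]])
    then show ?thesis using \<open>c \<noteq> 0\<close> by (simp add: field_simps)
  qed
  then show ?thesis using \<open>c \<noteq> 0\<close> by (intro exI[of _ "1 / c"]) auto
qed

end

lemma cbasis_in_dspan: "i < n \<Longrightarrow> cbasis lam gam i \<in> dspan n lam gam"
  unfolding dspan_def
proof (rule range_eqI[of _ _ "\<lambda>k. if k = i then 1 else 0"], rule ext)
  fix \<mu> assume "i < n"
  then have "(\<Sum>k<n. Polynomial.smult (if k = i then 1 else 0) (cbasis lam gam k \<mu>)) = (\<Sum>k\<in>{i}. cbasis lam gam k \<mu>)"
    by (intro sum.mono_neutral_cong_right) auto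
  then show "cbasis lam gam i \<mu> = (\<Sum>k<n. Polynomial.smult (if k = i then 1 else 0) (cbasis lam gam k \<mu>))"
    by simp
qed

lemma suppC_dspan: "suppC (dspan n lam gam) = lam ` {..<n}"
proof
  show "suppC (dspan n lam gam) \<subseteq> lam ` {..<n}"
  proof
    fix \<mu> assume "\<mu> \<in> suppC (dspan n lam gam)"
    then obtain t where "(\<Sum>i<n. Polynomial.smult (t i) (cbasis lam gam i \<mu>)) \<noteq> 0"
      by (auto simp: suppC_def dspan_def)
    then obtain i where "i < n" "cbasis lam gam i \<mu> \<noteq> 0"
      by (metis (no_types, lifting) lessThan_iff smult_0_right sum.neutral)
    then show "\<mu> \<in> lam ` {..<n}" by (auto simp: cbasis_def split: if_splits)
  qed
  show "lam ` {..<n} \<subseteq> suppC (dspan n lam gam)"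
  proof
    fix \<mu> assume "\<mu> \<in> lam ` {..<n}"
    then obtain i where "i < n" "\<mu> = lam i" by blast
    moreover from this have "cbasis lam gam i \<mu> \<noteq> 0" by (simp add: cbasis_def)
    ultimately show "\<mu> \<in> suppC (dspan n lam gam)"
      using cbasis_in_dspan[of i n lam gam] by (auto simp: suppC_def)
  qed
qed

context airy
begin

text \<open>The hypotheses mention no basis of C, which settles the choice of basis. Two candidate
  operators are multiples of the same Wronskian operator, and their monic top coefficients make the
  factors equal.\<close>

lemma Kbar_eqI:
  assumes C: "inD C"
    and deg: "degree T \<le> r * nC C"
    and top: "lead_coeff (coeff T (r * nC C)) = 1"
             "coeff T (r * nC C - 1) = - pderiv (coeff T (r * nC C))"
    and kill: "\<And>D j x. D \<in> C \<Longrightarrow> j < r \<Longrightarrow> wact T (dhat D (f j)) x = 0"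
  shows "Kbar r a f C = T"
proof -
  \<comment> \<open>The basis chosen inside \<open>Kbar\<close> may list the nodes of C in another
    order than the basis at hand, so the locale is interpreted afresh for it.\<close>
  obtain n lam gam where b: "(SOME b. Dbasis C b) = (n, lam, gam)" by (metis prod_cases3)
  have "Dbasis C (n, lam, gam)"
    using C someI_ex[of "Dbasis C"] unfolding inD_def b by simp
  then have basis: "n \<ge> 1" "inj_on lam {..<n}" "C = dspan n lam gam" by (auto simp: Dbasis_def)
  interpret airy_nodes r a f n lam gam by unfold_locales (use basis in auto)
  have nC: "nC C = n"
    using basis(2) by (simp add: nC_def basis(3) suppC_dspan card_image)
  let ?W = "\<lambda>u x. wronsk (\<lambda>p. if p < r * n then phis r f lam gam p else u) (r * n + 1) x"
  let ?Q = "\<lambda>T \<kappa>. \<kappa> \<noteq> 0 \<and> (\<forall>u. entire u \<longrightarrow> (\<forall>x. wact T u x = \<kappa> * ?W u x))"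
  let ?P = "\<lambda>T. lead_coeff (coeff T (r * n)) = 1 \<and> (\<exists>\<kappa>. ?Q T \<kappa>)"
  have "wact T (phis r f lam gam p) x = 0" if "p < r * n" for p x
    unfolding phis_def using that r basis
    by (intro kill) (auto simp: less_mult_imp_div_less mult.commute intro!: cbasis_in_dspan)
  then have "\<exists>\<kappa>. \<kappa> \<noteq> 0 \<and> (\<forall>u. entire u \<longrightarrow> (\<forall>x. wact T u x = \<kappa> * ?W u x))"
    using deg top nC by (intro wact_eq_wronsk[of T "coeff T (r * n)"]) auto
  then have PT: "?P T" using top nC by simp
  have "T' = T" if PT': "?P T'" for T'
  proof -
    obtain \<kappa> where Q: "?Q T \<kappa>" by (rule exE[OF conjunct2[OF PT]])
    obtain \<kappa>' where Q': "?Q T' \<kappa>'" by (rule exE[OF conjunct2[OF PT']])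
    note \<kappa> = conjunct1[OF Q] conjunct2[OF Q, rule_format]
    note \<kappa>' = conjunct1[OF Q'] conjunct2[OF Q', rule_format]
    have "Polynomial.smult [:\<kappa>':] T = Polynomial.smult [:\<kappa>:] T'"
      by (rule weyl_eqI) (simp add: wact_smult \<kappa> \<kappa>' entire_shift f_entire)
    then have "Polynomial.smult \<kappa>' (coeff T k) = Polynomial.smult \<kappa> (coeff T' k)" for k
      by (metis coeff_smult mult_pCons_left mult_zero_left add_0_right pCons_0_0)
    moreover from this[of "r * n"] have "\<kappa>' = \<kappa>"
      using PT PT' by (metis lead_coeff_smult mult.right_neutral)
    ultimately show ?thesis using \<kappa> by (intro poly_eqI) (metis smult_cancel)
  qed
  then have "(SOME T. ?P T) = T" using PT by blast
  then show ?thesis by (simp add: Kbar_def b)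
qed

end

subsection \<open>Recovering the distributions from the operator\<close>

lemma poly_higher_pderiv_root:
  fixes p :: "complex poly"
  shows "i \<le> k \<Longrightarrow> poly ((pderiv ^^ i) ([:- c, 1:] ^ k * p)) c = (if i = k then fact k * poly p c else 0)"
proof (induction i arbitrary: k p)
  case 0
  then show ?case by (cases k) auto
next
  case (Suc i)
  then obtain k' where k: "k = Suc k'" by (cases k) auto
  define p1 where "p1 = Polynomial.smult (of_nat k) p + [:- c, 1:] * pderiv p"
  have "pderiv ([:- c, 1:] ^ k * p) = [:- c, 1:] ^ k' * p1"
    by (simp add: k p1_def pderiv_mult pderiv_power_Suc pderiv_pCons algebra_simps del: power_Suc)
       (simp add: algebra_simps)
  then have "poly ((pderiv ^^ Suc i) ([:- c, 1:] ^ k * p)) c = poly ((pderiv ^^ i) ([:- c, 1:] ^ k' * p1)) c"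
    by (simp only: funpow_Suc_right o_def)
  also have "\<dots> = (if i = k' then fact k' * poly p1 c else 0)"
    using Suc k by (intro Suc.IH) auto
  finally show ?case by (simp add: k p1_def)
qed

lemma higher_deriv_mult_root:
  assumes "entire h" "j \<le> k"
  shows "(deriv ^^ j) (\<lambda>z. poly ([:- c, 1:] ^ k * p) z * h z) c = (if j = k then fact k * poly p c * h c else 0)"
proof -
  have "(deriv ^^ j) (\<lambda>z. poly ([:- c, 1:] ^ k * p) z * h z) c
     = (\<Sum>i=0..j. of_nat (j choose i) * poly ((pderiv ^^ i) ([:- c, 1:] ^ k * p)) c * (deriv ^^ (j - i)) h c)"
    using higher_deriv_mult[OF entire_poly assms(1) open_UNIV, of c j "[:- c, 1:] ^ k * p"]
    by (simp add: higher_deriv_poly)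
  also have "\<dots> = (\<Sum>i=0..j. if i = k then fact k * poly p c * h c else 0)"
    using assms(2) by (intro sum.cong refl) (auto simp: poly_higher_pderiv_root)
  finally show ?thesis using assms(2) by auto
qed

context airy
begin

text \<open>Multiplication by a polynomial s(z) is performed from the x-side as s(L_0). With s
  vanishing to order d, the order of E, at mu0 and to a higher order than E at the other support
  points, only the top coefficient times f_j(mu0) is left; the f_j have no common zero.\<close>

lemma dhat_eq_0_imp:
  assumes E: "E \<in> Sdist" and zero: "\<And>j x. j < r \<Longrightarrow> dhat E (f j) x = 0"
  shows "E \<mu>0 = 0"
proof (rule ccontr)
  assume nz: "E \<mu>0 \<noteq> 0"
  define F where "F = {\<mu>. E \<mu> \<noteq> 0}"
  have F: "finite F" "\<mu>0 \<in> F" using E nz by (auto simp: F_def Sdist_def)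
  define d where "d = degree (E \<mu>0)"
  define K where "K = Suc (\<Sum>\<mu>\<in>F. degree (E \<mu>))"
  have K: "degree (E \<mu>) < K" if "\<mu> \<in> F" for \<mu>
    using member_le_sum[of \<mu> F "\<lambda>\<mu>. degree (E \<mu>)"] F that by (simp add: K_def)
  define p where "p = (\<Prod>\<mu>\<in>F - {\<mu>0}. [:- \<mu>, 1:] ^ K)"
  define s where "s = [:- \<mu>0, 1:] ^ d * p"
  have p0: "poly p \<mu>0 \<noteq> 0" using F by (auto simp: p_def poly_prod)
  have "f j (0 + \<mu>0) = 0" if j: "j < r" for j
  proof -
    define h where "h z = f j (0 + z)" for z
    have h: "entire h" unfolding h_def using f_entire[OF j] by (simp add: cong: holomorphic_cong)
    have other: "pact (E \<mu>) (\<lambda>z. poly s z * h z) \<mu> = 0" if \<mu>: "\<mu> \<in> F - {\<mu>0}" for \<mu>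
    proof -
      have "[:- \<mu>, 1:] ^ K dvd p"
        unfolding p_def using \<mu> F by (intro dvd_prodI) auto
      then obtain p' where "s = [:- \<mu>, 1:] ^ K * p'"
        unfolding s_def by (meson dvdE dvd_mult)
      then show ?thesis
        unfolding pact_def using K[of \<mu>] \<mu>
        by (intro sum.neutral ballI) (simp add: higher_deriv_mult_root[OF h] del: poly_mult poly_power)
    qed
    have self: "pact (E \<mu>0) (\<lambda>z. poly s z * h z) \<mu>0 = coeff (E \<mu>0) d * (fact d * poly p \<mu>0 * h \<mu>0)"
    proof -
      have "pact (E \<mu>0) (\<lambda>z. poly s z * h z) \<mu>0 = (\<Sum>j\<in>{d}. coeff (E \<mu>0) d * (fact d * poly p \<mu>0 * h \<mu>0))"
        unfolding pact_def s_def d_def[symmetric]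
        by (intro sum.mono_neutral_cong_right) (auto simp: higher_deriv_mult_root[OF h] simp del: poly_mult poly_power)
      then show ?thesis by simp
    qed
    have "dhat E (f j) = (\<lambda>_. 0)" using zero[OF j] by blast
    then have "0 = wact (pL0 r a s) (dhat E (f j)) 0"
      using wact_cmult[of "\<lambda>_. 0" "pL0 r a s" 0 0] by simp
    also have "\<dots> = dapp E (\<lambda>z. poly s z * h z)"
      by (simp add: wact_dhat f_entire[OF j] wact_pL0_shift[OF f_ker[OF j]] h_def)
    also have "\<dots> = (\<Sum>\<mu>\<in>F. pact (E \<mu>) (\<lambda>z. poly s z * h z) \<mu>)"
      using F by (intro dapp_superset) (auto simp: F_def)
    also have "\<dots> = coeff (E \<mu>0) d * (fact d * poly p \<mu>0 * h \<mu>0)"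
      using F other by (subst sum.remove[of _ \<mu>0]) (auto simp: self)
    finally show ?thesis using p0 nz by (simp add: d_def h_def)
  qed
  then have "(\<Sum>m<r. (if m = 0 then 1 else 0) * (deriv ^^ m) (f j) (0 + \<mu>0)) = 0" if "j < r" for j
    using that r sum_delta_left(2)[of 0 r "\<lambda>_. 1" "\<lambda>m. (deriv ^^ m) (f j) (0 + \<mu>0)"] by simp
  from wronskian_vanish[of "\<lambda>m. if m = 0 then 1 else 0", OF this, of 0] show False using r by simp
qed

end

section \<open>The two highest coefficients of a product in the Weyl algebra\<close>

definition wterm :: "weyl \<Rightarrow> weyl \<Rightarrow> nat \<Rightarrow> nat \<Rightarrow> nat \<Rightarrow> complex poly" where
  "wterm A B i j l = Polynomial.smult (of_nat (i choose l)) (coeff A i * (pderiv ^^ l) (coeff B j))"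

lemma coeff_wmult:
  "coeff (wmult A B) e = (\<Sum>(i,j)\<in>{..degree A} \<times> {..degree B}. \<Sum>l\<le>i. if i + j - l = e then wterm A B i j l else 0)"
  unfolding wmult_def coeff_sum sum.cartesian_product[symmetric]
  by (simp add: coeff_monom wterm_def eq_commute cong: if_cong)

lemma sum_wterm:
  fixes c :: "nat \<Rightarrow> complex poly"
  shows "i + j < e \<Longrightarrow> (\<Sum>l\<le>i. if i + j - l = e then c l else 0) = 0"
    and "i + j = e \<Longrightarrow> (\<Sum>l\<le>i. if i + j - l = e then c l else 0) = c 0"
    and "i + j = Suc e \<Longrightarrow> (\<Sum>l\<le>i. if i + j - l = e then c l else 0) = (if i = 0 then 0 else c 1)"
proof -
  show "(\<Sum>l\<le>i. if i + j - l = e then c l else 0) = 0" if "i + j < e"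
    using that by (intro sum.neutral) auto
  show "(\<Sum>l\<le>i. if i + j - l = e then c l else 0) = c 0" if "i + j = e"
  proof -
    have "(\<Sum>l\<le>i. if i + j - l = e then c l else 0) = (\<Sum>l\<in>{0::nat}. c 0)"
      using that by (intro sum.mono_neutral_cong_right) auto
    then show ?thesis by simp
  qed
  show "(\<Sum>l\<le>i. if i + j - l = e then c l else 0) = (if i = 0 then 0 else c 1)" if "i + j = Suc e"
  proof (cases "i = 0")
    case False
    have "(\<Sum>l\<le>i. if i + j - l = e then c l else 0) = (\<Sum>l\<in>{1::nat}. c 1)"
    proof (intro sum.mono_neutral_cong_right ballI)
      fix l assume "l \<in> {..i} - {1}"
      then have "i + j - l \<noteq> e" using that by auto
      then show "(if i + j - l = e then c l else 0) = 0" by simp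
    qed (use that False in auto)
    then show ?thesis using False by simp
  qed (use that in auto)
qed

lemma coeff_wmult_top:
  "coeff (wmult A B) (degree A + degree B) = lead_coeff A * lead_coeff B"
proof -
  let ?G = "\<lambda>i j. \<Sum>l\<le>i. if i + j - l = degree A + degree B then wterm A B i j l else 0"
  have "coeff (wmult A B) (degree A + degree B) = (\<Sum>(i,j)\<in>{(degree A, degree B)}. ?G i j)"
    unfolding coeff_wmult
  proof (intro sum.mono_neutral_right ballI)
    fix ij assume "ij \<in> {..degree A} \<times> {..degree B} - {(degree A, degree B)}"
    then have "fst ij + snd ij < degree A + degree B" by (cases ij) auto
    then show "(case ij of (i, j) \<Rightarrow> ?G i j) = 0"
      by (cases ij) (simp add: sum_wterm(1))
  qed auto
  then show ?thesis by (simp add: sum_wterm(2)) (simp add: wterm_def)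
qed

lemma coeff_wmult_subtop:
  assumes "degree B \<ge> 1"
  shows "coeff (wmult A B) (degree A + degree B - 1)
    = of_nat (degree A) * (lead_coeff A * pderiv (lead_coeff B))
      + (if degree A = 0 then 0 else coeff A (degree A - 1) * lead_coeff B)
      + lead_coeff A * coeff B (degree B - 1)"
proof -
  define d where "d = degree A"
  obtain N where N: "degree B = Suc N" using assms by (cases "degree B") auto
  define G where "G i j = (\<Sum>l\<le>i. if i + j - l = d + N then wterm A B i j l else 0)" for i j
  \<comment> \<open>The pairs reaching order d + N: one derivative falling on the leading
    coefficient of \<open>B\<close>, or none and one order lost in \<open>B\<close> or in
    \<open>A\<close>. For d = 0 the last pair must be left out, as d - 1 would be 0 again.\<close>
  define Z where "Z = {(d, Suc N), (d, N)} \<union> (if d = 0 then {} else {(d - 1, Suc N)})"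
  have "coeff (wmult A B) (d + N) = (\<Sum>(i, j)\<in>Z. G i j)"
    unfolding coeff_wmult N d_def[symmetric] G_def[symmetric]
  proof (intro sum.mono_neutral_right ballI)
    fix ij assume "ij \<in> {..d} \<times> {..Suc N} - Z"
    then have "fst ij + snd ij < d + N" by (cases ij) (auto simp: Z_def split: if_splits)
    then show "(case ij of (i, j) \<Rightarrow> G i j) = 0" by (cases ij) (simp add: G_def sum_wterm(1))
  qed (auto simp: Z_def split: if_splits)
  moreover have "G d (Suc N) = (if d = 0 then 0 else wterm A B d (Suc N) 1)" "G d N = wterm A B d N 0"
    unfolding G_def by (rule sum_wterm; simp)+
  moreover have "G (d - 1) (Suc N) = wterm A B (d - 1) (Suc N) 0" if "d \<noteq> 0"
    unfolding G_def by (rule sum_wterm(2)) (use that in simp)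
  ultimately have "coeff (wmult A B) (d + N) = of_nat d * (coeff A d * pderiv (coeff B (Suc N)))
      + (if d = 0 then 0 else coeff A (d - 1) * coeff B (Suc N)) + coeff A d * coeff B N"
    by (cases "d = 0") (simp_all add: Z_def wterm_def of_nat_poly)
  then show ?thesis using N by (simp add: d_def)
qed

definition lift_const :: "complex poly \<Rightarrow> weyl" where
  "lift_const p = map_poly (\<lambda>c. [:c:]) p"

lemma coeff_lift_const [simp]: "coeff (lift_const p) k = [:coeff p k:]"
  by (simp add: lift_const_def coeff_map_poly)

lemma degree_lift_const [simp]: "degree (lift_const p) = degree p"
  by (simp add: lift_const_def degree_map_poly)

lemma wact_lift_const: "wact (lift_const p) h \<mu> = pact p h \<mu>"
  by (simp add: wact_def pact_def)

context airy
begin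

text \<open>\<open>E\<close> is the composite D o T2: the product \<open>G\<close> with its
  coefficients evaluated at the support point, because delta_mu acts last. By \<open>dual\<close> it
  kills all f_j(x+z), so it vanishes by \<open>dhat_eq_0_imp\<close>.\<close>

lemma annihilated_degree:
  assumes D: "D \<in> Sdist"
    and zero: "\<And>j x. j < r \<Longrightarrow> wact T1 (dhat D (f j)) x = 0"
    and dual: "\<And>j x z. j < r \<Longrightarrow> wact T1 (\<lambda>x. f j (x + z)) x = wact T2 (\<lambda>z. f j (x + z)) z"
    and T2: "degree T2 = N" "N \<ge> 1" "coeff T2 N = t" "coeff T2 (N - 1) = - pderiv t"
    and simple: "\<And>\<mu>. poly t \<mu> = 0 \<Longrightarrow> poly (pderiv t) \<mu> \<noteq> 0"
    and nz: "D \<mu> \<noteq> 0"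
  shows "degree (D \<mu>) = 1 \<and> poly t \<mu> = 0"
proof -
  define F where "F = {\<mu>. D \<mu> \<noteq> 0}"
  have F: "finite F" using D by (simp add: F_def Sdist_def)
  define G where "G \<mu> = wmult (lift_const (D \<mu>)) T2" for \<mu>
  define E where "E \<mu> = (if \<mu> \<in> F then map_poly (\<lambda>p. poly p \<mu>) (G \<mu>) else 0)" for \<mu>
  have coeff_E: "coeff (E \<mu>) k = poly (coeff (G \<mu>) k) \<mu>" if "\<mu> \<in> F" for \<mu> k
    using that by (simp add: E_def coeff_map_poly)
  have pact_E: "pact (E \<mu>) h \<mu> = pact (D \<mu>) (wact T2 h) \<mu>" if "\<mu> \<in> F" "entire h" for \<mu> h
  proof -
    have "degree (E \<mu>) \<le> degree (G \<mu>)"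
      using that(1) by (simp add: E_def degree_map_poly_le)
    then have "pact (E \<mu>) h \<mu> = wact (G \<mu>) h \<mu>"
      by (simp add: pact_bound wact_def coeff_E[OF that(1)])
    then show ?thesis using that(2) by (simp add: G_def wact_wmult wact_lift_const)
  qed
  have ES: "E \<in> Sdist"
    unfolding Sdist_def using F by (auto simp: E_def elim!: finite_subset[rotated])
  have "dhat E (f j) x = 0" if j: "j < r" for j x
  proof -
    have h: "entire (\<lambda>z. f j (x + z))" by (intro entire_shift' f_entire j)
    have "dhat E (f j) x = (\<Sum>\<mu>\<in>F. pact (E \<mu>) (\<lambda>z. f j (x + z)) \<mu>)"
      unfolding dhat_def by (rule dapp_superset[OF F]) (auto simp: E_def)
    also have "\<dots> = (\<Sum>\<mu>\<in>F. pact (D \<mu>) (wact T2 (\<lambda>z. f j (x + z))) \<mu>)"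
      by (intro sum.cong refl pact_E h)
    also have "\<dots> = dapp D (wact T2 (\<lambda>z. f j (x + z)))"
      using F by (intro dapp_superset[symmetric]) (auto simp: F_def)
    also have "wact T2 (\<lambda>z. f j (x + z)) = (\<lambda>z. wact T1 (\<lambda>x. f j (x + z)) x)"
      using dual[OF j] by auto
    also have "dapp D \<dots> = 0"
      using zero[OF j, of x] by (simp add: wact_dhat f_entire[OF j])
    finally show ?thesis .
  qed
  then have "E \<mu> = 0" by (intro dhat_eq_0_imp ES)
  then have G0: "poly (coeff (G \<mu>) k) \<mu> = 0" for k
    using coeff_E[of \<mu> k] nz by (simp add: F_def)
  let ?d = "degree (D \<mu>)"
  have lc: "lead_coeff (D \<mu>) \<noteq> 0" using nz by simp
  have root: "poly t \<mu> = 0"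
    using G0[of "?d + N"] coeff_wmult_top[of "lift_const (D \<mu>)" T2] T2 lc by (simp add: G_def)
  \<comment> \<open>In this order the multiples of t vanish at the root. The derivative falling on t
    contributes d t', the second coefficient of T2 contributes -t'.\<close>
  have "of_nat ?d * (lead_coeff (D \<mu>) * poly (pderiv t) \<mu>) - lead_coeff (D \<mu>) * poly (pderiv t) \<mu> = 0"
    using G0[of "?d + N - 1"] coeff_wmult_subtop[of T2 "lift_const (D \<mu>)"] T2 root
    by (simp add: G_def del: leading_coeff_0_iff split: if_splits)
  then have "(of_nat ?d - 1) * (lead_coeff (D \<mu>) * poly (pderiv t) \<mu>) = 0"
    by (simp add: algebra_simps)
  then have "of_nat ?d = (1 :: complex)"
    using lc simple[OF root] by simp
  then have "?d = 1" by (metis of_nat_1 of_nat_eq_iff)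
  then show ?thesis using root by simp
qed

end

lemma dapp_diff:
  assumes "D \<in> Sdist" "E \<in> Sdist"
  shows "(\<lambda>\<mu>. D \<mu> - E \<mu>) \<in> Sdist" "dapp (\<lambda>\<mu>. D \<mu> - E \<mu>) g = dapp D g - dapp E g"
proof -
  let ?S = "{\<mu>. D \<mu> \<noteq> 0} \<union> {\<mu>. E \<mu> \<noteq> 0}"
  have S: "finite ?S" using assms by (simp add: Sdist_def)
  show "(\<lambda>\<mu>. D \<mu> - E \<mu>) \<in> Sdist"
    unfolding Sdist_def by (rule CollectI, rule finite_subset[OF _ S]) auto
  have "pact (p - q) g \<mu> = pact p g \<mu> - pact q g \<mu>" for p q \<mu>
    using pact_add[of p "- q" g \<mu>] pact_smult[of "- 1" q g \<mu>] by simp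
  moreover have "dapp (\<lambda>\<mu>. D \<mu> - E \<mu>) g = (\<Sum>\<mu>\<in>?S. pact (D \<mu> - E \<mu>) g \<mu>)"
    by (rule dapp_superset[OF S]) auto
  ultimately have "dapp (\<lambda>\<mu>. D \<mu> - E \<mu>) g = (\<Sum>\<mu>\<in>?S. pact (D \<mu>) g \<mu> - pact (E \<mu>) g \<mu>)"
    by simp
  also have "\<dots> = dapp D g - dapp E g"
    unfolding sum_subtractf
    by (intro arg_cong2[of _ _ _ _ "(-)"] dapp_superset[OF S, symmetric]) auto
  finally show "dapp (\<lambda>\<mu>. D \<mu> - E \<mu>) g = dapp D g - dapp E g" .
qed

lemma dspan_subset_Sdist: "dspan n lam gam \<subseteq> Sdist"
proof
  fix D assume "D \<in> dspan n lam gam"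
  then have "{\<mu>. D \<mu> \<noteq> 0} \<subseteq> lam ` {..<n}"
    using suppC_dspan[of n lam gam] by (auto simp: suppC_def)
  then show "D \<in> Sdist"
    by (auto simp: Sdist_def intro: finite_subset)
qed

context airy_nodes
begin

text \<open>Subtracting from D the element of the span with the same first-order coefficients at the
  nodes leaves an annihilated E. Where E is nonzero it would have order exactly 1 at a node, but its
  first-order coefficient there is 0.\<close>

lemma annihilated_eq_dspan:
  assumes dual: "\<And>j x z. j < r \<Longrightarrow> wact T1 (\<lambda>x. f j (x + z)) x = wact T2 (\<lambda>z. f j (x + z)) z"
    and T2: "degree T2 \<le> r * n" "coeff T2 (r * n) = q" "coeff T2 (r * n - 1) = - pderiv q"
    and kill: "\<And>i g x. i < n \<Longrightarrow> g \<in> kerL0 r a \<Longrightarrow> wact T1 (dhat (cbasis lam gam i) g) x = 0"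
  shows "{c \<in> Sdist. \<forall>g\<in>kerL0 r a. wact T1 (dhat c g) = (\<lambda>_. 0)} = dspan n lam gam"
proof
  show "dspan n lam gam \<subseteq> {c \<in> Sdist. \<forall>g\<in>kerL0 r a. wact T1 (dhat c g) = (\<lambda>_. 0)}"
    using dspan_subset_Sdist wact_dspan[OF kerL0_entire] kill by blast
  show "{c \<in> Sdist. \<forall>g\<in>kerL0 r a. wact T1 (dhat c g) = (\<lambda>_. 0)} \<subseteq> dspan n lam gam"
  proof
    fix D assume "D \<in> {c \<in> Sdist. \<forall>g\<in>kerL0 r a. wact T1 (dhat c g) = (\<lambda>_. 0)}"
    then have D: "D \<in> Sdist" and D0: "\<And>j x. j < r \<Longrightarrow> wact T1 (dhat D (f j)) x = 0"
      using f_ker by auto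
    define B where "B = (\<lambda>\<mu>. \<Sum>i<n. Polynomial.smult (coeff (D (lam i)) 1) (cbasis lam gam i \<mu>))"
    have B: "B \<in> dspan n lam gam" by (auto simp: B_def dspan_def)
    then have BS: "B \<in> Sdist" using dspan_subset_Sdist by blast
    define E where "E = (\<lambda>\<mu>. D \<mu> - B \<mu>)"
    have ES: "E \<in> Sdist" unfolding E_def by (rule dapp_diff[OF D BS])
    have E0: "wact T1 (dhat E (f j)) x = 0" if j: "j < r" for j x
    proof -
      have "wact T1 (dhat E (f j)) x = wact T1 (dhat D (f j)) x - wact T1 (dhat B (f j)) x"
        unfolding wact_dhat[OF f_entire[OF j]] E_def by (rule dapp_diff(2)[OF D BS])
      then show ?thesis
        using D0[OF j] wact_dspan[OF f_entire[OF j] B kill[OF _ f_ker[OF j]]] by simp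
    qed
    have q0: "q \<noteq> 0" using monic_q by force
    then have degT2: "degree T2 = r * n" using T2 by (intro antisym le_degree) auto
    have simple: "poly (pderiv q) \<mu> \<noteq> 0" if "poly q \<mu> = 0" for \<mu>
      using that poly_qi_self pderiv_q_lam by (auto simp: poly_q_eq_0_iff)
    have "E \<mu> = 0" for \<mu>
    proof (rule ccontr)
      assume nz: "E \<mu> \<noteq> 0"
      have "degree (E \<mu>) = 1 \<and> poly q \<mu> = 0"
        by (rule annihilated_degree[OF ES E0 dual degT2 _ T2(2,3) simple nz]) (use r n in auto)
      then obtain i where i: "i < n" "\<mu> = lam i" "degree (E \<mu>) = 1" by (auto simp: poly_q_eq_0_iff)
      have "B (lam i) = (\<Sum>k\<in>{i}. Polynomial.smult (coeff (D (lam i)) 1) [:gam i, 1:])"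
        unfolding B_def using i(1) inj
        by (intro sum.mono_neutral_cong_right) (auto simp: cbasis_def inj_on_def)
      then have "coeff (E \<mu>) 1 = 0" by (simp add: E_def i(2))
      then show False using i(3) nz by (metis leading_coeff_0_iff)
    qed
    then have "D = B" by (auto simp: E_def fun_eq_iff)
    then show "D \<in> dspan n lam gam" using B by simp
  qed
qed

lemma Kbar_dspan: "Kbar r a f (dspan n lam gam) = Tx"
  and nC_dspan: "nC (dspan n lam gam) = n"
  and qC_dspan: "qC (dspan n lam gam) = q"
  and inD_dspan: "inD (dspan n lam gam)"
proof -
  show nC: "nC (dspan n lam gam) = n"
    using inj by (simp add: nC_def suppC_dspan card_image)
  show "qC (dspan n lam gam) = q"
    using inj by (simp add: qC_def suppC_dspan q_def prod.reindex)
  show inD: "inD (dspan n lam gam)"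
    using inj n by (auto simp: inD_def Dbasis_def)
  show "Kbar r a f (dspan n lam gam) = Tx"
  proof (rule Kbar_eqI[OF inD])
    fix D j x assume D: "D \<in> dspan n lam gam" and j: "j < r"
    show "wact Tx (dhat D (f j)) x = 0"
      by (rule wact_dspan[OF f_entire[OF j] D Tx_annihilates[OF f_ker[OF j]]])
  qed (simp_all only: nC degree_Tx coeff_Tx coeff_Tx' monic_tau_X)
qed

end

theorem mainTheorem12:
  fixes r :: nat and a :: "nat \<Rightarrow> complex" and f :: "nat \<Rightarrow> complex \<Rightarrow> complex"
    and C :: "sdist set"
  assumes "r > 1"
    and "\<forall>j<r. f j \<in> kerL0 r a"
    and "\<forall>g\<in>kerL0 r a. \<exists>c. g = (\<lambda>x. \<Sum>j<r. c j * f j x)"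
    and "\<forall>x. wronsk f r x = 1"
    and "C \<in> D0 r a f"
  shows "tau r a f (Cbeta r a f C) = qC C
    \<and> wflat r a (Kbar r a f C) = Kbar r a f (Cbeta r a f C)
    \<and> Cbeta r a f C \<in> D0 r a f
    \<and> Cbeta r a f (Cbeta r a f C) = C"
proof -
  interpret airy r a f by unfold_locales (use assms in auto)
  obtain n lam gam where b: "n \<ge> 1" "inj_on lam {..<n}" "C = dspan n lam gam"
    using \<open>C \<in> D0 r a f\<close> by (auto simp: D0_def inD_def Dbasis_def)
  interpret C: airy_nodes r a f n lam gam by unfold_locales (use b in auto)
  have KC: "Kbar r a f C = C.Tx" using C.Kbar_dspan b(3) by simp
  have "rsquarefree C.tau_X"
    using \<open>C \<in> D0 r a f\<close> by (simp add: D0_def tau_def b(3) C.Kbar_dspan C.nC_dspan C.coeff_Tx)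
  define Z where "Z = {z. poly C.tau_X z = 0}"
  have tau_prod: "C.tau_X = (\<Prod>z\<in>Z. [:- z, 1:])"
    using complex_poly_decompose_rsquarefree[OF \<open>rsquarefree C.tau_X\<close>] by (simp add: Z_def C.monic_tau_X)
  have simple: "poly (pderiv C.tau_X) z \<noteq> 0" if "poly C.tau_X z = 0" for z
    using \<open>rsquarefree C.tau_X\<close> that by (auto simp: rsquarefree_roots)
  have "C.tau_X \<noteq> 0" using C.monic_tau_X by force
  then have "finite Z" unfolding Z_def by (rule poly_roots_finite)
  moreover have "card Z = n"
    using C.degree_tau_X by (simp add: tau_prod degree_prod_eq_sum_degree)
  ultimately obtain mu where mu: "bij_betw mu {..<n} Z"
    using ex_bij_betw_nat_finite[of Z] by (auto simp: atLeast0LessThan)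
  define C' where "C' = dspan n mu (\<lambda>i. C.gam_dual (mu i))"
  interpret C': airy_nodes r a f n mu "\<lambda>i. C.gam_dual (mu i)"
    by unfold_locales (use b mu in \<open>auto simp: bij_betw_def\<close>)
  have q': "C'.q = C.tau_X"
    using mu unfolding C'.q_def tau_prod by (rule prod.reindex_bij_betw)
  have killz: "wact C.Tz (dhat (cbasis mu (\<lambda>i. C.gam_dual (mu i)) i) g) x = 0"
    if "i < n" "g \<in> kerL0 r a" for i g x
  proof -
    have "poly C.tau_X (mu i) = 0" using mu that(1) by (auto simp: bij_betw_def Z_def)
    then show ?thesis
      using C.Tz_annihilates[OF that(2) _ simple] by (simp add: cbasis_def)
  qed
  \<comment> \<open>The operator is recognized by its top coefficients q, -q' and the functions it
    kills; this replaces a comparison of the Calogero-Moser matrices of C' with the transposes of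
    those of C.\<close>
  have KC': "Kbar r a f C' = C.Tz"
    unfolding C'_def
  proof (rule Kbar_eqI[OF C'.inD_dspan])
    fix D j x assume D: "D \<in> dspan n mu (\<lambda>i. C.gam_dual (mu i))" and j: "j < r"
    show "wact C.Tz (dhat D (f j)) x = 0"
      by (rule wact_dspan[OF f_entire[OF j] D killz[OF _ f_ker[OF j]]])
  qed (simp_all only: C'.nC_dspan C.degree_Tz C.coeff_Tz C.coeff_Tz' C.monic_q)
  have beta: "Cbeta r a f C = C'"
    unfolding Cbeta_def KC C.wflat_Tx C'_def
  proof (rule C'.annihilated_eq_dspan[OF _ _ _ _ killz])
    show "wact C.Tz (\<lambda>x. f j (x + z)) x = wact C.Tx (\<lambda>z. f j (x + z)) z" if "j < r" for j x z
      using C.Tx_Tz[OF f_ker[OF that], of x z] by (simp add: add.commute)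
  qed (auto simp: q' C.degree_Tx C.coeff_Tx C.coeff_Tx'[unfolded One_nat_def])
  \<comment> \<open>The same lemma as for \<open>beta\<close> with \<open>Tx\<close> and
    \<open>Tz\<close> exchanged, now at the original nodes, since flat takes \<open>Tz\<close> back
    to \<open>Tx\<close>.\<close>
  have beta': "Cbeta r a f C' = C"
    unfolding Cbeta_def KC' C.wflat_Tz b(3)
    by (rule C.annihilated_eq_dspan[OF C.Tx_Tz[OF f_ker]])
       (auto simp: C.degree_Tz C.coeff_Tz C.coeff_Tz'[unfolded One_nat_def] C.Tx_annihilates)
  have tau': "tau r a f C' = qC C"
    unfolding tau_def KC' b(3) C.qC_dspan by (simp add: C'_def C'.nC_dspan C.coeff_Tz)
  have "rsquarefree (qC C)"
    unfolding b(3) C.qC_dspan rsquarefree_roots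
    using C.poly_qi_self C.pderiv_q_lam by (auto simp: C.poly_q_eq_0_iff)
  then have "C' \<in> D0 r a f"
    using tau' C'.inD_dspan by (simp add: D0_def C'_def)
  then show ?thesis
    using beta beta' tau' KC KC' C.wflat_Tx by simp
qed

end
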